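(* Let $Q\in\mathbb{R}^{n\times m}_+$ be a column-stochastic matrix (a classical channel with $m$ inputs and $n$ outputs), let $\mathcal{N}\in\Phi(\mathcal{H}_A,\mathcal{H}_B)$ be a quantum channel, and let $\mathcal{E}\in\Phi(\mathcal{H}_X,\mathcal{H}_A)$ be an encoding channel, where $\mathcal{H}_X\cong\mathbb{C}^m$ has orthonormal basis $\{|j\rangle\}$ and $\rho_j=\mathcal{E}(|j\rangle\langle j|)$. Then: (a) $-I_c$ is $\zeta_Q$-smooth and $\eta_Q$-strongly convex relative to the negative Shannon entropy $-H$ on $\Delta_m$, where $I_c(p)=\sum_{j=1}^m\sum_{i=1}^n p_jQ_{ij}\log\big(Q_{ij}/\sum_{k=1}^m p_kQ_{ik}\big)$; (b) $-\chi$ is $\zeta_{\mathcal{N}\circ\mathcal{E}}$-smooth and $\eta_{\mathcal{N}\circ\mathcal{E}}$-strongly convex relative to $-H$ on $\Delta_m$, where $\chi(p)=S\big(\mathcal{N}(\sum_{j}p_j\rho_j)\big)-\sum_j p_jS(\mathcal{N}(\rho_j))$; (c) $-I_q$ is $(1+\zeta_{\mathcal{N}}-\eta_{\mathcal{N}_c})$-smooth and $(1+\eta_{\mathcal{N}}-\zeta_{\mathcal{N}_c})$-strongly convex relative to the negative von Neumann entropy $-S$ on $\mathcal{D}(\mathcal{H}_A)$, where $I_q(\rho)=S(\rho)+S(\mathcal{N}(\rho))-S(\mathcal{N}_c(\rho))$.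
   Context: $\Delta_m$ is the probability simplex in $\mathbb{R}^m$; $H(x)=-\sum_i x_i\log x_i$, $H(x\|y)=\sum_i x_i\log(x_i/y_i)$; $\mathcal{D}(\mathcal{H})$ is the set of density matrices; $S(\rho)=-\operatorname{tr}[\rho\log\rho]$, $S(\rho\|\sigma)=\operatorname{tr}[\rho(\log\rho-\log\sigma)]$. $\Phi(\mathcal{H}_A,\mathcal{H}_B)$ denotes completely positive trace-preserving maps. If $\mathcal{N}(\rho)=\operatorname{tr}_E(U\rho U^\dagger)$ is a Stinespring representation with isometry $U:\mathcal{H}_A\to\mathcal{H}_B\otimes\mathcal{H}_E$, the complementary channel is $\mathcal{N}_c(\rho)=\operatorname{tr}_B(U\rho U^\dagger)$. Channel coefficients: $\zeta_Q=\sup\{H(Qp\|Qq)/H(p\|q):p,q\in\Delta_m,p\ne q\}$, $\eta_Q=\inf\{\cdot\}$ of the same ratio; for a quantum channel $\mathcal{M}\in\Phi(\mathcal{H},\mathcal{H}')$, $\zeta_{\mathcal{M}}=\sup\{S(\mathcal{M}(\rho)\|\mathcal{M}(\sigma))/S(\rho\|\sigma):\rho,\sigma\in\mathcal{D}(\mathcal{H}),\rho\ne\sigma\}$ and $\eta_{\mathcal{M}}$ is the corresponding infimum. A function $f$ is $L$-smooth (resp. $\mu$-strongly convex) relative to a Legendre function $\varphi$ on a convex set $\mathcal{C}$ if $L\varphi-f$ (resp. $f-\mu\varphi$) is convex on the relative interior of $\mathcal{C}$. *)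

theory Defs
  imports "HOL-Analysis.Analysis"
begin

definition prob_simplex :: "(real^'m::finite) set" where
  "prob_simplex = {p. (\<forall>i. 0 \<le> p $ i) \<and> (\<Sum>i\<in>UNIV. p $ i) = 1}"

text \<open>Shannon entropy (natural log; 0 log 0 = 0 since ln 0 = 0 in Isabelle).\<close>
definition shannon :: "real^'m::finite \<Rightarrow> real" where
  "shannon p = - (\<Sum>i\<in>UNIV. p $ i * ln (p $ i))"

text \<open>Relative entropy H(p||q) (finite value, used when supp p \<subseteq> supp q).\<close>
definition kl_div :: "real^'m::finite \<Rightarrow> real^'m \<Rightarrow> real" where
  "kl_div p q = (\<Sum>i\<in>UNIV. p $ i * ln (p $ i / q $ i))"

definition supp_sub :: "real^'m::finite \<Rightarrow> real^'m \<Rightarrow> bool" where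
  "supp_sub p q \<longleftrightarrow> (\<forall>i. q $ i = 0 \<longrightarrow> p $ i = 0)"

definition column_stochastic :: "real^'m::finite^'n::finite \<Rightarrow> bool" where
  "column_stochastic Q \<longleftrightarrow> (\<forall>i j. 0 \<le> Q $ i $ j) \<and> (\<forall>j. (\<Sum>i\<in>UNIV. Q $ i $ j) = 1)"

text \<open>Contraction / expansion coefficients zeta_Q and eta_Q. The ratio is taken
  over the pairs p \<noteq> q for which H(p||q) is finite (supp p \<subseteq> supp q).\<close>
definition cratios :: "real^'m::finite^'n::finite \<Rightarrow> real set" where
  "cratios Q = {kl_div (Q *v p) (Q *v q) / kl_div p q | p q.
      p \<in> prob_simplex \<and> q \<in> prob_simplex \<and> p \<noteq> q \<and> supp_sub p q}"

definition zetaC :: "real^'m::finite^'n::finite \<Rightarrow> real" where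
  "zetaC Q = Sup (cratios Q)"

definition etaC :: "real^'m::finite^'n::finite \<Rightarrow> real" where
  "etaC Q = Inf (cratios Q)"

definition Ic :: "real^'m::finite^'n::finite \<Rightarrow> real^'m \<Rightarrow> real" where
  "Ic Q p = (\<Sum>j\<in>UNIV. \<Sum>i\<in>UNIV.
      p $ j * Q $ i $ j * ln (Q $ i $ j / (\<Sum>k\<in>UNIV. p $ k * Q $ i $ k)))"

type_synonym 'a cmat = "complex^'a^'a"

definition ctrans :: "complex^'a::finite^'b::finite \<Rightarrow> complex^'b^'a" where
  "ctrans A = (\<chi> i j. cnj (A $ j $ i))"

definition hermitian :: "complex^'a::finite^'a \<Rightarrow> bool" where
  "hermitian A \<longleftrightarrow> ctrans A = A"

definition qform :: "complex^'a::finite^'a \<Rightarrow> complex^'a \<Rightarrow> complex" where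
  "qform A v = (\<Sum>i\<in>UNIV. \<Sum>j\<in>UNIV. cnj (v $ i) * A $ i $ j * v $ j)"

definition psd :: "complex^'a::finite^'a \<Rightarrow> bool" where
  "psd A \<longleftrightarrow> hermitian A \<and> (\<forall>v. 0 \<le> Re (qform A v))"

definition unitary_mat :: "complex^'a::finite^'a \<Rightarrow> bool" where
  "unitary_mat U \<longleftrightarrow> ctrans U ** U = mat 1 \<and> U ** ctrans U = mat 1"

definition isometry :: "complex^'a::finite^'c::finite \<Rightarrow> bool" where
  "isometry U \<longleftrightarrow> ctrans U ** U = mat 1"

definition density :: "(complex^'a::finite^'a) set" where
  "density = {\<rho>. psd \<rho> \<and> trace \<rho> = 1}"

text \<open>Functional calculus for Hermitian matrices via a spectral decomposition
  A = U diag(d) U^\<dagger> (the result does not depend on the chosen decomposition).\<close>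
definition diagm :: "('a::finite \<Rightarrow> real) \<Rightarrow> complex^'a^'a" where
  "diagm d = (\<chi> i j. if i = j then complex_of_real (d i) else 0)"

definition mfun :: "(real \<Rightarrow> real) \<Rightarrow> complex^'a::finite^'a \<Rightarrow> complex^'a^'a" where
  "mfun f A = (SOME B. \<exists>U d. unitary_mat U \<and> A = U ** diagm d ** ctrans U
                          \<and> B = U ** diagm (f \<circ> d) ** ctrans U)"

definition vN :: "complex^'a::finite^'a \<Rightarrow> real" where
  "vN \<rho> = - Re (trace (\<rho> ** mfun ln \<rho>))"

definition qrel :: "complex^'a::finite^'a \<Rightarrow> complex^'a^'a \<Rightarrow> real" where
  "qrel \<rho> \<sigma> = Re (trace (\<rho> ** (mfun ln \<rho> - mfun ln \<sigma>)))"

text \<open>supp rho \<subseteq> supp sigma, i.e. ker sigma \<subseteq> ker rho (S(rho||sigma) finite).\<close>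
definition qsupp_sub :: "complex^'a::finite^'a \<Rightarrow> complex^'a^'a \<Rightarrow> bool" where
  "qsupp_sub \<rho> \<sigma> \<longleftrightarrow> (\<forall>v. \<sigma> *v v = 0 \<longrightarrow> \<rho> *v v = 0)"

text \<open>Quantum channels Phi(H_A,H_B): complex-linear, completely positive
  (Choi matrix positive semidefinite), trace preserving.\<close>
definition cscale :: "complex \<Rightarrow> complex^'a::finite^'b::finite \<Rightarrow> complex^'a^'b" where
  "cscale c A = (\<chi> i j. c * A $ i $ j)"

definition ketbra :: "'a::finite \<Rightarrow> 'a \<Rightarrow> complex^'a^'a" where
  "ketbra i j = (\<chi> k l. if k = i \<and> l = j then 1 else 0)"

definition choi :: "(complex^'a::finite^'a \<Rightarrow> complex^'b::finite^'b) \<Rightarrow> complex^('a \<times> 'b)^('a \<times> 'b)" where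
  "choi N = (\<chi> x y. N (ketbra (fst x) (fst y)) $ snd x $ snd y)"

definition qchannel :: "(complex^'a::finite^'a \<Rightarrow> complex^'b::finite^'b) \<Rightarrow> bool" where
  "qchannel N \<longleftrightarrow> (\<forall>A B. N (A + B) = N A + N B) \<and> (\<forall>c A. N (cscale c A) = cscale c (N A))
     \<and> psd (choi N) \<and> (\<forall>A. trace (N A) = trace A)"

definition ptrace_E :: "complex^('b::finite \<times> 'e::finite)^('b \<times> 'e) \<Rightarrow> complex^'b^'b" where
  "ptrace_E M = (\<chi> b b'. \<Sum>e\<in>UNIV. M $ (b, e) $ (b', e))"

definition ptrace_B :: "complex^('b::finite \<times> 'e::finite)^('b \<times> 'e) \<Rightarrow> complex^'e^'e" where
  "ptrace_B M = (\<chi> e e'. \<Sum>b\<in>UNIV. M $ (b, e) $ (b, e'))"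

text \<open>Coefficients zeta_M and eta_M of a quantum channel (ratio over pairs
  rho \<noteq> sigma with S(rho||sigma) finite).\<close>
definition qratios :: "(complex^'a::finite^'a \<Rightarrow> complex^'b::finite^'b) \<Rightarrow> real set" where
  "qratios M = {qrel (M \<rho>) (M \<sigma>) / qrel \<rho> \<sigma> | \<rho> \<sigma>.
      \<rho> \<in> density \<and> \<sigma> \<in> density \<and> \<rho> \<noteq> \<sigma> \<and> qsupp_sub \<rho> \<sigma>}"

definition zetaQ :: "(complex^'a::finite^'a \<Rightarrow> complex^'b::finite^'b) \<Rightarrow> real" where
  "zetaQ M = Sup (qratios M)"

definition etaQ :: "(complex^'a::finite^'a \<Rightarrow> complex^'b::finite^'b) \<Rightarrow> real" where
  "etaQ M = Inf (qratios M)"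

definition holevo :: "(complex^'a::finite^'a \<Rightarrow> complex^'b::finite^'b)
     \<Rightarrow> (complex^'m::finite^'m \<Rightarrow> complex^'a^'a) \<Rightarrow> real^'m \<Rightarrow> real" where
  "holevo N E p = vN (N (\<Sum>j\<in>UNIV. p $ j *\<^sub>R E (ketbra j j)))
                   - (\<Sum>j\<in>UNIV. p $ j * vN (N (E (ketbra j j))))"

definition Iq :: "complex^'a::finite^('b::finite \<times> 'e::finite) \<Rightarrow> complex^'a^'a \<Rightarrow> real" where
  "Iq U \<rho> = vN \<rho> + vN (ptrace_E (U ** \<rho> ** ctrans U)) - vN (ptrace_B (U ** \<rho> ** ctrans U))"

definition rel_smooth :: "real \<Rightarrow> ('v::real_vector \<Rightarrow> real) \<Rightarrow> ('v \<Rightarrow> real) \<Rightarrow> 'v set \<Rightarrow> bool" where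
  "rel_smooth L f \<phi> S \<longleftrightarrow> convex_on S (\<lambda>x. L * \<phi> x - f x)"

definition rel_strongly_convex :: "real \<Rightarrow> ('v::real_vector \<Rightarrow> real) \<Rightarrow> ('v \<Rightarrow> real) \<Rightarrow> 'v set \<Rightarrow> bool" where
  "rel_strongly_convex \<mu> f \<phi> S \<longleftrightarrow> convex_on S (\<lambda>x. f x - \<mu> * \<phi> x)"

end

theory Submission
  imports Defs
begin

text \<open>
  For any matrices and \<open>z = (1 - t) x + t y\<close>, the Jensen gap \<open>S(z) - (1 - t) S(x) - t S(y)\<close> equals
  \<open>(1 - t) S(x\<parallel>z) + t S(y\<parallel>z)\<close>. Each of the functions in the theorem is, up to an affine term, a
  combination of entropies of channel outputs, so its Jensen gap is bounded by that of the
  reference entropy through the ratios defining \<open>\<zeta>\<close> and \<open>\<eta>\<close>; the supports are automatically nested.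

  The suprema and infima are meaningful because the ratios lie in \<open>[0, 1]\<close>, i.e. by Klein's
  inequality and the data processing inequality. The latter follows from
  \<open>p (ln p - ln q) = \<integral>\<^sub>0\<^sup>\<infinity> p\<^sup>2 / (q + t p) - p / (1 + t) dt\<close>, which reduces it to the monotonicity of
  \<open>\<langle>\<rho>, (L\<^sub>\<sigma> + t R\<^sub>\<rho>)\<^sup>-\<^sup>1 \<rho>\<rangle>\<close> for every \<open>t > 0\<close>, where \<open>L\<^sub>\<sigma>\<close> and \<open>R\<^sub>\<rho>\<close> are left and right
  multiplication. This quantity is the supremum over \<open>X\<close> of
  \<open>2 Re tr (X\<^sup>* \<rho>) - tr (X X\<^sup>* \<sigma>) - t tr (X\<^sup>* X \<rho>)\<close>, and replacing \<open>X\<close> by its image under the dual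
  channel does not decrease the functional, by the Kadison--Schwarz inequality.
\<close>

section \<open>Matrices and the spectral theorem\<close>

lemma matrix_mult_nth: "(A ** B) $ i $ j = (\<Sum>k\<in>UNIV. A $ i $ k * B $ k $ j)"
  by (simp add: matrix_matrix_mult_def)

lemma matrix_add_rdistrib:
  fixes A :: "'a::semiring_1^'n::finite^'m"
  shows "(A + B) ** C = A ** C + B ** C"
  by (simp add: vec_eq_iff matrix_mult_nth distrib_right sum.distrib)

lemma matrix_diff_ldistrib:
  fixes A :: "'a::ring_1^'n::finite^'m"
  shows "A ** (B - C) = A ** B - A ** C"
  by (simp add: vec_eq_iff matrix_mult_nth right_diff_distrib sum_subtractf)

lemma matrix_diff_rdistrib:
  fixes A :: "'a::ring_1^'n::finite^'m"
  shows "(A - B) ** C = A ** C - B ** C"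
  by (simp add: vec_eq_iff matrix_mult_nth left_diff_distrib sum_subtractf)

lemma matrix_sum_ldistrib:
  fixes A :: "'a::semiring_1^'n::finite^'m"
  shows "A ** (\<Sum>k\<in>S. B k) = (\<Sum>k\<in>S. A ** B k)"
  by (simp add: vec_eq_iff matrix_mult_nth sum_distrib_left) (intro allI sum.swap)

lemma matrix_sum_rdistrib:
  fixes B :: "'a::semiring_1^'n::finite^'m"
  shows "(\<Sum>k\<in>S. A k) ** B = (\<Sum>k\<in>S. A k ** B)"
  by (simp add: vec_eq_iff matrix_mult_nth sum_distrib_right) (intro allI sum.swap)

lemma matrix_mult_scaleR_right:
  fixes A :: "complex^'n::finite^'m"
  shows "A ** (r *\<^sub>R B) = r *\<^sub>R (A ** B)"
  by (simp add: vec_eq_iff matrix_mult_nth scaleR_sum_right)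

lemma matrix_mult_scaleR_left:
  fixes A :: "complex^'n::finite^'m"
  shows "(r *\<^sub>R A) ** B = r *\<^sub>R (A ** B)"
  by (simp add: vec_eq_iff matrix_mult_nth scaleR_sum_right)

lemma trace_sum: "trace (\<Sum>k\<in>S. A k :: complex^'n::finite^'n) = (\<Sum>k\<in>S. trace (A k))"
  by (induction S rule: infinite_finite_induct) (simp_all add: trace_add, simp_all add: trace_def)

lemma trace_scaleR: "trace (r *\<^sub>R A :: complex^'n::finite^'n) = r *\<^sub>R trace A"
  by (simp add: trace_def scaleR_sum_right)

lemma ctrans_nth [simp]: "ctrans A $ i $ j = cnj (A $ j $ i)"
  by (simp add: ctrans_def)

lemma ctrans_ctrans [simp]: "ctrans (ctrans A) = A"
  by (simp add: vec_eq_iff)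

lemma ctrans_mult: "ctrans (A ** B) = ctrans B ** ctrans A"
  by (simp add: vec_eq_iff matrix_mult_nth mult.commute)

lemma ctrans_add: "ctrans (A + B) = ctrans A + ctrans B"
  by (simp add: vec_eq_iff)

lemma ctrans_diff: "ctrans (A - B) = ctrans A - ctrans B"
  by (simp add: vec_eq_iff)

lemma ctrans_zero: "ctrans 0 = 0"
  by (simp add: vec_eq_iff)

lemma ctrans_sum: "ctrans (\<Sum>k\<in>S. A k) = (\<Sum>k\<in>S. ctrans (A k))"
  by (induction S rule: infinite_finite_induct) (simp_all add: ctrans_add ctrans_zero)

lemma ctrans_scaleR: "ctrans (r *\<^sub>R A) = r *\<^sub>R ctrans A"
  by (simp add: vec_eq_iff)

lemma diagm_nth: "diagm d $ i $ j = (if i = j then complex_of_real (d i) else 0)"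
  by (simp add: diagm_def)

lemma ctrans_diagm [simp]: "ctrans (diagm d) = diagm d"
  by (simp add: vec_eq_iff diagm_nth)

lemma mult_diagm_nth: "(A ** diagm d) $ i $ j = A $ i $ j * complex_of_real (d j)"
  by (simp add: matrix_mult_nth diagm_nth if_distrib [where f = "\<lambda>x. _ * x"] cong: if_cong)

lemma diagm_mult_nth: "(diagm d ** A) $ i $ j = complex_of_real (d i) * A $ i $ j"
  by (simp add: matrix_mult_nth diagm_nth if_distrib [where f = "\<lambda>x. x * _"] cong: if_cong)

section \<open>The complex inner product and the spectral theorem\<close>

definition cinner :: "complex^'a::finite \<Rightarrow> complex^'a \<Rightarrow> complex" where
  "cinner v w = (\<Sum>i\<in>UNIV. cnj (v $ i) * w $ i)"

lemma Re_cinner: "Re (cinner v w) = v \<bullet> w"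
  by (simp add: cinner_def inner_vec_def inner_complex_def)

lemma Im_cinner: "Im (cinner v w) = (\<i> *s v) \<bullet> w"
  by (simp add: cinner_def inner_vec_def inner_complex_def algebra_simps)

text \<open>Turns complex orthogonality into two real conditions, so that real dimension counts
  apply to \<open>complex^'a\<close>.\<close>

lemma cinner_eq_0_iff: "cinner v w = 0 \<longleftrightarrow> v \<bullet> w = 0 \<and> (\<i> *s v) \<bullet> w = 0"
  by (simp add: complex_eq_iff Re_cinner Im_cinner)

lemma cinner_commute: "cinner v w = cnj (cinner w v)"
  by (simp add: cinner_def mult.commute)

lemma cinner_self: "cinner v v = complex_of_real ((norm v)\<^sup>2)"
  by (simp add: complex_eq_iff Re_cinner power2_norm_eq_inner)
    (simp add: cinner_def)

lemma cinner_add_right: "cinner v (w + x) = cinner v w + cinner v x"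
  by (simp add: cinner_def algebra_simps sum.distrib)

lemma cinner_scaleR_right: "cinner v (r *\<^sub>R w) = r *\<^sub>R cinner v w"
  by (simp add: cinner_def scaleR_sum_right)

lemma cinner_scaleR_left: "cinner (r *\<^sub>R v) w = r *\<^sub>R cinner v w"
  by (simp add: cinner_def scaleR_sum_right)

lemma cinner_zero_right: "cinner v 0 = 0"
  by (simp add: cinner_def)

lemma cinner_matrix_left: "cinner (A *v v) w = cinner v (ctrans A *v w)"
  unfolding cinner_def matrix_vector_mult_def
  by (simp add: sum_distrib_left sum_distrib_right, subst sum.swap) (simp add: mult_ac)

lemma qform_eq_cinner: "qform A v = cinner v (A *v v)"
  by (simp add: qform_def cinner_def matrix_vector_mult_def sum_distrib_left mult_ac)

lemma complex_matrix_vector_scaleR: "A *v (r *\<^sub>R v) = r *\<^sub>R (A *v v)" for A :: "complex^'a::finite^'b"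
  by (simp add: vec_eq_iff matrix_vector_mult_def scaleR_sum_right)

text \<open>Rayleigh principle: let \<open>v\<close> maximise the quadratic form of \<open>f\<close>
  on the unit sphere of \<open>W\<close>, with value \<open>l\<close>. Then \<open>B = l - f\<close>
  is nonnegative on \<open>W\<close> and its form vanishes at \<open>v\<close>, which forces
  \<open>B v = 0\<close>. Working over the reals makes the eigenvalue real from the outset.\<close>

lemma selfadjoint_eigenvector:
  fixes f :: "'v::euclidean_space \<Rightarrow> 'v"
  assumes lin: "linear f" and sa: "\<And>x y. f x \<bullet> y = x \<bullet> f y"
    and W: "subspace W" and inv: "\<And>w. w \<in> W \<Longrightarrow> f w \<in> W"
    and w0: "w0 \<in> W" "w0 \<noteq> 0"
  obtains v where "v \<in> W" "norm v = 1" "f v = (v \<bullet> f v) *\<^sub>R v"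
proof -
  have cont: "continuous_on UNIV f"
    using lin by (simp add: linear_continuous_on linear_linear)
  have "compact (sphere 0 1 \<inter> W)"
    using W by (simp add: closed_subspace compact_Int_closed)
  moreover have "(1 / norm w0) *\<^sub>R w0 \<in> sphere 0 1 \<inter> W"
    using w0 W by (simp add: subspace_scale)
  moreover have "continuous_on (sphere 0 1 \<inter> W) (\<lambda>w. w \<bullet> f w)"
    by (intro continuous_intros continuous_on_subset [OF cont]) auto
  ultimately obtain v where v: "v \<in> sphere 0 1 \<inter> W"
    and vmax: "\<And>w. w \<in> sphere 0 1 \<inter> W \<Longrightarrow> w \<bullet> f w \<le> v \<bullet> f v"
    using continuous_attains_sup [of "sphere 0 1 \<inter> W" "\<lambda>w. w \<bullet> f w"] by blast
  define l where "l = v \<bullet> f v"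
  define B where "B w = l *\<^sub>R w - f w" for w
  have vv: "v \<bullet> v = 1" and vW: "v \<in> W" "norm v = 1"
    using v by (auto simp: norm_eq_1)
  have psdB: "0 \<le> w \<bullet> B w" if "w \<in> W" for w
  proof (cases "w = 0")
    case False
    let ?u = "(1 / norm w) *\<^sub>R w"
    have "?u \<bullet> f ?u \<le> l"
      unfolding l_def using that False W by (intro vmax) (simp add: subspace_scale)
    moreover have "?u \<bullet> f ?u = (w \<bullet> f w) / (norm w)\<^sup>2"
      using lin by (simp add: linear_scale power2_eq_square)
    ultimately have "(w \<bullet> f w) / (w \<bullet> w) \<le> l"
      by (simp only: power2_norm_eq_inner)
    then have "w \<bullet> f w \<le> l * (w \<bullet> w)"
      using False by (simp add: divide_le_eq)
    then show ?thesis by (simp add: B_def inner_diff_right)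
  qed (simp add: B_def)
  have "B v \<in> W"
    unfolding B_def using vW W inv by (simp add: subspace_diff subspace_scale)
  define u where "u = B v"
  have uW: "u \<in> W" using \<open>B v \<in> W\<close> by (simp add: u_def)
  have Blin: "B (v + s *\<^sub>R u) = B v + s *\<^sub>R B u" for s
    using lin by (simp add: B_def linear_add linear_scale algebra_simps)
  have vBu: "v \<bullet> B u = u \<bullet> u"
  proof -
    have "v \<bullet> B u = B v \<bullet> u"
      by (simp add: B_def inner_diff_left inner_diff_right sa)
    then show ?thesis by (simp add: u_def)
  qed
  have vBv: "v \<bullet> B v = 0"
    by (simp add: B_def inner_diff_right vv l_def)
  \<comment> \<open>The form of \<open>B\<close> along the line through \<open>v\<close> in
    direction \<open>u\<close>. The constant term is zero, so the linear coefficient has to vanish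
    as well.\<close>
  have quad: "0 \<le> 2 * s * (u \<bullet> u) + s\<^sup>2 * (u \<bullet> B u)" for s
  proof -
    have "0 \<le> (v + s *\<^sub>R u) \<bullet> B (v + s *\<^sub>R u)"
      using vW uW W by (intro psdB) (simp add: subspace_add subspace_scale)
    then show ?thesis
      by (simp add: Blin inner_add_left inner_add_right vBu vBv [unfolded u_def [symmetric]]
          power2_eq_square u_def [symmetric] algebra_simps)
  qed
  have "u \<bullet> u = 0"
  proof (rule ccontr)
    assume "u \<bullet> u \<noteq> 0"
    then have pos: "0 < u \<bullet> u" by simp
    have nn: "0 \<le> u \<bullet> B u" by (rule psdB [OF uW])
    \<comment> \<open>The minimiser would be \<open>- (u \<bullet> u) / (u \<bullet> B u)\<close>;
      the added 1 covers the case \<open>u \<bullet> B u = 0\<close> and still gives a negative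
      value.\<close>
    define s where "s = - (u \<bullet> u) / (1 + u \<bullet> B u)"
    have "s * (u \<bullet> B u) = s * (1 + u \<bullet> B u) - s" by (simp add: algebra_simps)
    also have "\<dots> = - (u \<bullet> u) - s" using nn by (simp add: s_def)
    finally have "2 * s * (u \<bullet> u) + s\<^sup>2 * (u \<bullet> B u) = s * (u \<bullet> u - s)"
      by (simp add: power2_eq_square mult.assoc) (simp add: algebra_simps)
    moreover have "s < 0" using pos nn by (simp add: s_def divide_neg_pos)
    ultimately show False
      using quad [of s] pos by (simp add: zero_le_mult_iff)
  qed
  then have "f v = l *\<^sub>R v" by (simp add: u_def B_def)
  with vW show thesis using that [of v] by (simp add: l_def)
qed

text \<open>Induction on the index set: a new eigenvector is found in the orthogonal complement of
  the earlier ones, which \<open>A\<close> preserves because it is Hermitian. Indexing by the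
  matrix's own index type makes the case \<open>S = UNIV\<close> a full set of columns of a
  unitary.\<close>

lemma hermitian_orthonormal_eigenvectors:
  fixes A :: "complex^'a::finite^'a" and S :: "'a set"
  assumes "hermitian A"
  shows "\<exists>F d. (\<forall>i\<in>S. \<forall>j\<in>S. cinner (F i) (F j) = (if i = j then 1 else 0))
     \<and> (\<forall>i\<in>S. A *v F i = d i *\<^sub>R F i)"
  using finite [of S]
proof (induction S rule: finite_induct)
  case empty
  then show ?case by simp
next
  case (insert k S)
  then obtain F d where on: "\<forall>i\<in>S. \<forall>j\<in>S. cinner (F i) (F j) = (if i = j then 1 else 0)"
    and ev: "\<forall>i\<in>S. A *v F i = d i *\<^sub>R F i" by blast
  have herm: "ctrans A = A" using assms by (simp add: hermitian_def)
  define W where "W = {w. \<forall>i\<in>S. cinner (F i) w = 0}"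
  \<comment> \<open>A real spanning set of the complex span of the earlier eigenvectors. Its real
    dimension is at most \<open>2 * card S\<close>, which is below
    \<open>DIM(complex^'a) = 2 * CARD('a)\<close>, so \<open>W\<close> contains a nonzero
    vector.\<close>
  define R where "R = F ` S \<union> (\<lambda>i. \<i> *s F i) ` S"
  have "card S < CARD('a)"
    using insert.hyps by (metis UNIV_I finite psubsetI psubset_card_mono subset_UNIV)
  have "dim R \<le> card R" by (rule dim_le_card') (simp add: R_def)
  also have "\<dots> \<le> card (F ` S) + card ((\<lambda>i. \<i> *s F i) ` S)"
    by (simp add: R_def card_Un_le)
  also have "\<dots> \<le> card S + card S"
    by (intro add_mono card_image_le) simp_all
  also have "\<dots> < DIM(complex^'a)"
    using \<open>card S < CARD('a)\<close> by simp
  finally obtain w0 where w0: "w0 \<noteq> 0" "\<And>y. y \<in> span R \<Longrightarrow> orthogonal w0 y"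
    by (rule orthogonal_to_subspace_exists) blast
  have "w0 \<in> W"
    unfolding W_def cinner_eq_0_iff
    using w0(2) by (auto simp: R_def orthogonal_def inner_commute [of w0] intro: span_base)
  have "subspace W"
    by (auto simp: W_def subspace_def cinner_add_right cinner_scaleR_right cinner_zero_right)
  moreover have "A *v w \<in> W" if "w \<in> W" for w
  proof -
    have "cinner (F i) (A *v w) = 0" if "i \<in> S" for i
    proof -
      have "cinner (F i) (A *v w) = cinner (A *v F i) w"
        by (simp add: cinner_matrix_left herm)
      then show ?thesis
        using ev \<open>w \<in> W\<close> that by (simp add: W_def cinner_scaleR_left)
    qed
    then show ?thesis by (simp add: W_def)
  qed
  moreover have "linear ((*v) A)"
    by (rule linearI) (simp_all add: matrix_vector_right_distrib complex_matrix_vector_scaleR)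
  moreover have "(A *v x) \<bullet> y = x \<bullet> (A *v y)" for x y
    by (metis Re_cinner cinner_matrix_left herm)
  ultimately obtain v where v: "v \<in> W" "norm v = 1" "A *v v = (v \<bullet> (A *v v)) *\<^sub>R v"
    using selfadjoint_eigenvector [of "(*v) A" W w0] \<open>w0 \<in> W\<close> w0(1) by metis
  have vo: "cinner (F i) v = 0" "cinner v (F i) = 0" if "i \<in> S" for i
    using v(1) that cinner_commute [of v "F i"] by (auto simp: W_def)
  show ?case
    using on ev v insert.hyps
    by (intro exI [of _ "F(k := v)"] exI [of _ "d(k := v \<bullet> (A *v v))"])
      (auto simp: vo cinner_self [of v])
qed

theorem hermitian_spectral:
  fixes A :: "complex^'a::finite^'a"
  assumes "hermitian A"
  obtains U d where "unitary_mat U" "A = U ** diagm d ** ctrans U"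
proof -
  obtain F :: "'a \<Rightarrow> complex^'a" and d :: "'a \<Rightarrow> real"
    where on: "\<forall>i j. cinner (F i) (F j) = (if i = j then 1 else 0)"
    and ev: "\<forall>i. A *v F i = d i *\<^sub>R F i"
    using hermitian_orthonormal_eigenvectors [OF assms, of UNIV] by (simp only: ball_UNIV) blast
  define U where "U = (\<chi> i j. F j $ i)"
  have 1: "ctrans U ** U = mat 1"
    using on by (simp add: vec_eq_iff matrix_mult_nth U_def mat_def cinner_def)
  then have 2: "U ** ctrans U = mat 1"
    by (rule matrix_left_right_inverse [THEN iffD1])
  have "A ** U = U ** diagm d"
  proof -
    have "(A ** U) $ i $ j = (A *v F j) $ i" for i j
      by (simp add: matrix_mult_nth U_def matrix_vector_mult_def)
    then show ?thesis
      by (simp add: vec_eq_iff mult_diagm_nth ev)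
        (simp add: U_def scaleR_conv_of_real mult.commute)
  qed
  then have "A = U ** diagm d ** ctrans U"
    by (metis 2 matrix_mul_assoc matrix_mul_rid)
  with 1 2 show thesis by (intro that [of U d]) (simp_all add: unitary_mat_def)
qed

text \<open>Independence of the spectral decomposition, which pins down the choice in
  \<open>mfun\<close>: the unitary \<open>W\<close> between two eigenbases has a nonzero entry only
  where the two eigenvalues agree, so it also intertwines the diagonals after applying
  \<open>f\<close>.\<close>

lemma mfun_eq:
  assumes "unitary_mat U" "A = U ** diagm d ** ctrans U"
  shows "mfun f A = U ** diagm (f \<circ> d) ** ctrans U"
proof -
  have "V ** diagm (f \<circ> e) ** ctrans V = U ** diagm (f \<circ> d) ** ctrans U"
    if V: "unitary_mat V" and A: "A = V ** diagm e ** ctrans V" for V e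
  proof -
    have U1: "ctrans U ** U = mat 1" "U ** ctrans U = mat 1"
      and V1: "ctrans V ** V = mat 1" "V ** ctrans V = mat 1"
      using assms V by (auto simp: unitary_mat_def)
    define W where "W = ctrans V ** U"
    have "W ** diagm d = ctrans V ** (U ** diagm d ** ctrans U) ** U"
      by (metis U1(1) W_def matrix_mul_assoc matrix_mul_rid)
    also have "\<dots> = ctrans V ** (V ** diagm e ** ctrans V) ** U"
      using assms(2) A by simp
    also have "\<dots> = diagm e ** W"
      by (metis V1(1) W_def matrix_mul_assoc matrix_mul_lid)
    finally have eq: "W $ i $ j * complex_of_real (d j) = complex_of_real (e i) * W $ i $ j" for i j
      by (metis diagm_mult_nth mult_diagm_nth)
    have "W $ i $ j * complex_of_real (f (d j)) = complex_of_real (f (e i)) * W $ i $ j" for i j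
      using eq [of i j] by (cases "W $ i $ j = 0") auto
    then have "W ** diagm (f \<circ> d) = diagm (f \<circ> e) ** W"
      by (simp add: vec_eq_iff mult_diagm_nth diagm_mult_nth)
    then have "V ** (W ** diagm (f \<circ> d)) ** ctrans U = V ** (diagm (f \<circ> e) ** W) ** ctrans U"
      by simp
    then show ?thesis
      by (metis (no_types, lifting) U1(2) V1(2) W_def matrix_mul_assoc matrix_mul_lid matrix_mul_rid)
  qed
  then show ?thesis
    unfolding mfun_def using assms by (intro some_equality) blast+
qed

section \<open>Quadratic forms, positive semidefinite matrices and traces in eigenbases\<close>

lemma qform_conj: "qform (B ** A ** ctrans B) v = qform A (ctrans B *v v)"
proof -
  have "(B ** A ** ctrans B) *v v = B *v (A *v (ctrans B *v v))"
    by (simp add: matrix_vector_mul_assoc matrix_mul_assoc)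
  then show ?thesis
    by (metis cinner_matrix_left ctrans_ctrans qform_eq_cinner)
qed

lemma qform_diagm: "qform (diagm d) v = complex_of_real (\<Sum>i\<in>UNIV. d i * (cmod (v $ i))\<^sup>2)"
proof -
  have "(\<Sum>j\<in>UNIV. cnj (v $ i) * diagm d $ i $ j * v $ j) = cnj (v $ i) * complex_of_real (d i) * v $ i" for i
    by (simp add: diagm_nth if_distrib [where f = "\<lambda>x. _ * x * _"] cong: if_cong)
  moreover have "cnj (v $ i) * complex_of_real (d i) * v $ i = complex_of_real (d i * (cmod (v $ i))\<^sup>2)" for i
    by (simp only: of_real_mult complex_norm_square mult_ac)
  ultimately show ?thesis by (simp add: qform_def)
qed

lemma matrix_vector_mult_axis: "(A *v axis j 1) $ i = A $ i $ j" for A :: "complex^'a::finite^'b"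
  by (simp add: matrix_vector_mult_def axis_def if_distrib [where f = "\<lambda>x. _ * x"] cong: if_cong)

lemma qform_axis: "qform A (axis i 1) = A $ i $ i"
proof -
  have "(\<Sum>l\<in>UNIV. cnj (axis i 1 $ k) * A $ k $ l * axis i 1 $ l) = (if k = i then A $ i $ i else 0)" for k
    by (simp add: axis_def if_distrib [where f = "\<lambda>x. _ * x"] cong: if_cong)
  then show ?thesis by (simp add: qform_def)
qed

lemma qform_add: "qform (A + B) v = qform A v + qform B v"
  by (simp add: qform_def algebra_simps sum.distrib)

lemma qform_zero: "qform 0 v = 0"
  by (simp add: qform_def)

lemma qform_scaleR: "qform (r *\<^sub>R A) v = r *\<^sub>R qform A v"
  by (simp add: qform_def scaleR_sum_right)

lemma psd_zero: "psd 0"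
  by (simp add: psd_def hermitian_def ctrans_zero qform_zero)

lemma psd_add: "psd A \<Longrightarrow> psd B \<Longrightarrow> psd (A + B)"
  by (simp add: psd_def hermitian_def ctrans_add qform_add)

lemma psd_sum: "(\<And>k. k \<in> S \<Longrightarrow> psd (A k)) \<Longrightarrow> psd (\<Sum>k\<in>S. A k)"
  by (induction S rule: infinite_finite_induct) (auto simp: psd_zero psd_add)

lemma psd_scaleR: "psd A \<Longrightarrow> 0 \<le> r \<Longrightarrow> psd (r *\<^sub>R A)"
  by (simp add: psd_def hermitian_def ctrans_scaleR qform_scaleR)

lemma psd_conj: "psd A \<Longrightarrow> psd (B ** A ** ctrans B)"
  unfolding psd_def hermitian_def qform_conj
  by (simp add: ctrans_mult matrix_mul_assoc)

lemma Re_trace_psd_nonneg: "psd A \<Longrightarrow> 0 \<le> Re (trace A)"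
  unfolding trace_def by (simp add: sum_nonneg psd_def flip: qform_axis)

lemma psd_diagm: "(\<And>i. 0 \<le> d i) \<Longrightarrow> psd (diagm d)"
  by (simp add: psd_def hermitian_def qform_diagm sum_nonneg)

lemma psd_spectral:
  assumes "psd A"
  obtains U d where "unitary_mat U" "A = U ** diagm d ** ctrans U" "\<And>i. 0 \<le> d i"
proof -
  obtain U d where U: "unitary_mat U" "A = U ** diagm d ** ctrans U"
    using assms hermitian_spectral psd_def by blast
  have "ctrans U ** A ** U = (ctrans U ** U) ** diagm d ** (ctrans U ** U)"
    by (simp only: U(2) matrix_mul_assoc)
  then have "diagm d = ctrans U ** A ** ctrans (ctrans U)"
    using U(1) by (simp add: unitary_mat_def)
  then have "qform (diagm d) (axis i 1) = qform A (U *v axis i 1)" for i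
    by (metis ctrans_ctrans qform_conj)
  then have "0 \<le> Re (diagm d $ i $ i)" for i
    using assms by (simp add: psd_def qform_axis)
  then have "0 \<le> d i" for i
    by (simp add: diagm_nth)
  with U show thesis by (rule that)
qed

text \<open>In an eigenbasis the form is a sum of nonnegative terms, so each of them vanishes. This
  turns kernel conditions into conditions on forms, which are additive over Kraus terms and over
  mixtures.\<close>

lemma psd_qform_0_imp_null:
  assumes "psd A" "Re (qform A v) = 0"
  shows "A *v v = 0"
proof -
  obtain U d where U: "unitary_mat U" "A = U ** diagm d ** ctrans U" "\<And>i. 0 \<le> d i"
    using assms(1) psd_spectral by blast
  let ?w = "ctrans U *v v"
  have "(\<Sum>i\<in>UNIV. d i * (cmod (?w $ i))\<^sup>2) = 0"
    using assms(2) by (simp add: U(2) qform_conj qform_diagm)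
  then have "d i * (cmod (?w $ i))\<^sup>2 = 0" for i
    using U(3) by (subst (asm) sum_nonneg_eq_0_iff) auto
  then have "complex_of_real (d i) * ?w $ i = 0" for i
    by (metis mult_eq_0_iff norm_eq_zero of_real_0 power_eq_0_iff)
  then have "diagm d *v ?w = 0"
    by (simp add: vec_eq_iff matrix_vector_mult_def [of "diagm d"] diagm_nth
        if_distrib [where f = "\<lambda>x. x * _"] cong: if_cong)
  moreover have "A *v v = U *v (diagm d *v ?w)"
    by (simp add: U(2) matrix_vector_mul_assoc matrix_mul_assoc)
  ultimately show ?thesis by (simp add: matrix_vector_mult_0_right)
qed

text \<open>With its column version this makes the squared moduli of the entries doubly stochastic;
  they become the weights \<open>w\<close> of \<open>spectral_overlap\<close>.\<close>

lemma unitary_row_sum: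
  assumes "unitary_mat W"
  shows "(\<Sum>j\<in>UNIV. (cmod (W $ i $ j))\<^sup>2) = 1"
proof -
  have "(W ** ctrans W) $ i $ i = 1"
    using assms by (simp add: unitary_mat_def mat_def)
  then have "complex_of_real (\<Sum>j\<in>UNIV. (cmod (W $ i $ j))\<^sup>2) = 1"
    by (simp only: matrix_mult_nth ctrans_nth of_real_sum complex_norm_square)
  then show ?thesis using of_real_eq_1_iff by blast
qed

lemma unitary_column_sum:
  assumes "unitary_mat W"
  shows "(\<Sum>i\<in>UNIV. (cmod (W $ i $ j))\<^sup>2) = 1"
  using unitary_row_sum [of "ctrans W" j] assms by (simp add: unitary_mat_def)

lemma unitary_ctrans_mult:
  assumes "unitary_mat U" "unitary_mat V"
  shows "unitary_mat (ctrans U ** V)"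
proof -
  have "ctrans (ctrans U ** V) ** (ctrans U ** V) = ctrans V ** (U ** ctrans U) ** V"
    "(ctrans U ** V) ** ctrans (ctrans U ** V) = ctrans U ** (V ** ctrans V) ** U"
    by (simp_all add: ctrans_mult matrix_mul_assoc)
  then show ?thesis using assms by (simp add: unitary_mat_def)
qed

lemma trace_spectral:
  assumes "unitary_mat U"
  shows "trace (U ** diagm p ** ctrans U) = complex_of_real (\<Sum>i\<in>UNIV. p i)"
proof -
  have "trace (U ** diagm p ** ctrans U) = trace (ctrans U ** (U ** diagm p))"
    by (rule trace_mul_sym)
  also have "\<dots> = trace (diagm p)"
    using assms by (simp add: matrix_mul_assoc unitary_mat_def)
  finally show ?thesis by (simp add: trace_def diagm_nth)
qed

text \<open>Only the overlaps of the two eigenbases survive in the trace, so two noncommuting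
  matrices are handled by a scalar double sum.\<close>

lemma trace_spectral_product:
  "trace ((U ** diagm p ** ctrans U) ** (V ** diagm g ** ctrans V))
     = complex_of_real (\<Sum>i\<in>UNIV. \<Sum>j\<in>UNIV. (cmod ((ctrans U ** V) $ i $ j))\<^sup>2 * (p i * g j))"
proof -
  define W where "W = ctrans U ** V"
  have "trace ((U ** diagm p ** ctrans U) ** (V ** diagm g ** ctrans V))
      = trace (U ** (diagm p ** W ** diagm g ** ctrans V))"
    by (simp add: W_def matrix_mul_assoc)
  also have "\<dots> = trace ((diagm p ** W ** diagm g) ** ctrans W)"
    by (subst trace_mul_sym) (simp add: W_def ctrans_mult matrix_mul_assoc)
  also have "\<dots> = (\<Sum>i\<in>UNIV. \<Sum>j\<in>UNIV. complex_of_real ((cmod (W $ i $ j))\<^sup>2 * (p i * g j)))"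
    unfolding trace_def matrix_mult_nth [of "diagm p ** W ** diagm g"] mult_diagm_nth
      diagm_mult_nth ctrans_nth of_real_mult complex_norm_square
    by (simp only: mult_ac)
  finally show ?thesis by (simp only: W_def of_real_sum)
qed

section \<open>The data processing inequality\<close>

text \<open>The variational functional for the resolvent of \<open>L_\<sigma> + t R_\<rho>\<close>.
  It is defined without inverting that operator, so zero eigenvalues cause no trouble.\<close>

definition resolvent_obj :: "real \<Rightarrow> complex^'a::finite^'a \<Rightarrow> complex^'a^'a \<Rightarrow> complex^'a^'a \<Rightarrow> real" where
  "resolvent_obj t \<rho> \<sigma> X = 2 * Re (trace (ctrans X ** \<rho>)) - Re (trace (X ** ctrans X ** \<sigma>))
     - t * Re (trace (ctrans X ** X ** \<rho>))"

text \<open>The entries of \<open>Y\<close> are the coordinates of the argument in the eigenbasis of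
  \<sigma> on the left and of \<rho> on the right. They diagonalise both multiplications at once, so
  the functional splits into one scalar quadratic per entry.\<close>

lemma resolvent_obj_spectral:
  fixes U V Y :: "complex^'a::finite^'a"
  assumes U: "unitary_mat U" and V: "unitary_mat V"
  shows "resolvent_obj t (U ** diagm p ** ctrans U) (V ** diagm q ** ctrans V) (V ** Y ** ctrans U)
    = (\<Sum>i\<in>UNIV. \<Sum>j\<in>UNIV. 2 * Re (cnj (Y $ j $ i * (ctrans U ** V) $ i $ j)) * p i
        - (q j + t * p i) * (cmod (Y $ j $ i))\<^sup>2)"
proof -
  define W where "W = ctrans U ** V"
  have c: "ctrans U ** U = mat 1" "ctrans V ** V = mat 1"
    using U V by (simp_all add: unitary_mat_def)
  \<comment> \<open>Lets the simplifier cancel unitaries inside right-associated products.\<close>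
  have c': "ctrans U ** (U ** Z) = Z" "ctrans V ** (V ** Z) = Z" for Z :: "complex^'a^'a"
    by (simp_all add: matrix_mul_assoc c)
  have "trace (ctrans (V ** Y ** ctrans U) ** (U ** diagm p ** ctrans U))
      = trace (U ** (ctrans Y ** ctrans V ** U ** diagm p ** ctrans U))"
    by (simp add: ctrans_mult matrix_mul_assoc [symmetric] c')
  also have "\<dots> = trace ((ctrans Y ** ctrans W) ** diagm p)"
    by (subst trace_mul_sym) (simp add: W_def ctrans_mult matrix_mul_assoc [symmetric] c)
  also have "\<dots> = (\<Sum>i\<in>UNIV. \<Sum>j\<in>UNIV. cnj (Y $ j $ i * W $ i $ j) * complex_of_real (p i))"
    by (simp add: trace_def mult_diagm_nth matrix_mult_nth [of "ctrans Y"] sum_distrib_right)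
  finally have 1: "Re (trace (ctrans (V ** Y ** ctrans U) ** (U ** diagm p ** ctrans U)))
      = (\<Sum>i\<in>UNIV. \<Sum>j\<in>UNIV. Re (cnj (Y $ j $ i * W $ i $ j)) * p i)"
    by simp
  have "trace ((V ** Y ** ctrans U) ** ctrans (V ** Y ** ctrans U) ** (V ** diagm q ** ctrans V))
      = trace (V ** (Y ** ctrans Y ** diagm q ** ctrans V))"
    by (simp add: ctrans_mult matrix_mul_assoc [symmetric] c')
  also have "\<dots> = trace ((Y ** ctrans Y) ** diagm q)"
    by (subst trace_mul_sym) (simp add: matrix_mul_assoc [symmetric] c)
  also have "\<dots> = (\<Sum>j\<in>UNIV. \<Sum>i\<in>UNIV. complex_of_real (q j * (cmod (Y $ j $ i))\<^sup>2))"
    by (simp only: trace_def mult_diagm_nth matrix_mult_nth [of Y] sum_distrib_left ctrans_nth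
        of_real_mult complex_norm_square mult_ac)
  also have "\<dots> = (\<Sum>i\<in>UNIV. \<Sum>j\<in>UNIV. complex_of_real (q j * (cmod (Y $ j $ i))\<^sup>2))"
    by (rule sum.swap)
  finally have 2: "Re (trace ((V ** Y ** ctrans U) ** ctrans (V ** Y ** ctrans U) ** (V ** diagm q ** ctrans V)))
      = (\<Sum>i\<in>UNIV. \<Sum>j\<in>UNIV. q j * (cmod (Y $ j $ i))\<^sup>2)"
    by simp
  have "trace (ctrans (V ** Y ** ctrans U) ** (V ** Y ** ctrans U) ** (U ** diagm p ** ctrans U))
      = trace (U ** (ctrans Y ** Y ** diagm p ** ctrans U))"
    by (simp add: ctrans_mult matrix_mul_assoc [symmetric] c')
  also have "\<dots> = trace ((ctrans Y ** Y) ** diagm p)"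
    by (subst trace_mul_sym) (simp add: matrix_mul_assoc [symmetric] c)
  also have "\<dots> = (\<Sum>i\<in>UNIV. \<Sum>j\<in>UNIV. complex_of_real (p i * (cmod (Y $ j $ i))\<^sup>2))"
    by (simp only: trace_def mult_diagm_nth matrix_mult_nth [of "ctrans Y"] sum_distrib_left ctrans_nth
        of_real_mult complex_norm_square mult_ac)
  finally have 3: "Re (trace (ctrans (V ** Y ** ctrans U) ** (V ** Y ** ctrans U) ** (U ** diagm p ** ctrans U)))
      = (\<Sum>i\<in>UNIV. \<Sum>j\<in>UNIV. p i * (cmod (Y $ j $ i))\<^sup>2)"
    by simp
  show ?thesis
    unfolding resolvent_obj_def 1 2 3 W_def
    by (simp only: sum_distrib_left sum_subtractf [symmetric] distrib_right diff_diff_eq mult.assoc)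
qed

text \<open>Completing the square: the deficit is \<open>s\<close> times the squared distance of
  \<open>a\<close> from the maximiser. For \<open>s = 0\<close> both sides vanish because
  \<open>p = 0\<close> and \<open>0 / 0 = 0\<close>.\<close>

lemma quadratic_le_completed_square:
  fixes a c :: complex
  assumes "0 \<le> s" "s = 0 \<Longrightarrow> p = 0"
  shows "2 * Re (cnj (a * c)) * p - s * (cmod a)\<^sup>2 \<le> (cmod c)\<^sup>2 * (p\<^sup>2 / s)"
    and "a = cnj c * complex_of_real (p / s) \<Longrightarrow>
      2 * Re (cnj (a * c)) * p - s * (cmod a)\<^sup>2 = (cmod c)\<^sup>2 * (p\<^sup>2 / s)"
proof -
  have eq: "2 * Re (cnj (a * c)) * p - s * (cmod a)\<^sup>2
      = (cmod c)\<^sup>2 * (p\<^sup>2 / s) - s * (cmod (a - cnj c * complex_of_real (p / s)))\<^sup>2"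
  proof (cases "s = 0")
    case False
    define r where "r = p / s"
    have p: "p = r * s" using False by (simp add: r_def)
    have "s * (cmod (a - cnj c * complex_of_real r))\<^sup>2
        = s * (cmod a)\<^sup>2 - 2 * Re (cnj (a * c)) * (r * s) + (cmod c)\<^sup>2 * (r\<^sup>2 * s)"
      unfolding cmod_power2 by (simp add: power2_eq_square algebra_simps)
    moreover have "p\<^sup>2 / s = r\<^sup>2 * s" using False by (simp add: p power2_eq_square)
    ultimately show ?thesis by (simp only: r_def [symmetric]) (simp only: p)
  qed (use assms in simp)
  show "2 * Re (cnj (a * c)) * p - s * (cmod a)\<^sup>2 \<le> (cmod c)\<^sup>2 * (p\<^sup>2 / s)"
    unfolding eq using assms by simp
  show "2 * Re (cnj (a * c)) * p - s * (cmod a)\<^sup>2 = (cmod c)\<^sup>2 * (p\<^sup>2 / s)"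
    if "a = cnj c * complex_of_real (p / s)"
    unfolding eq using that by simp
qed

text \<open>Here \<open>p\<close> and \<open>q\<close> are the eigenvalues of \<open>\<rho>\<close> and \<open>\<sigma>\<close>, and \<open>w i j = |\<langle>u\<^sub>i, v\<^sub>j\<rangle>|\<^sup>2\<close> for the
  corresponding eigenvectors. Where \<open>q j + t p i = 0\<close> also \<open>p i = 0\<close>, so the quotient is
  \<open>0 / 0 = 0\<close>, as it should be.\<close>
definition spectral_overlap ::
  "complex^'a::finite^'a \<Rightarrow> complex^'a^'a \<Rightarrow> ('a \<Rightarrow> 'a \<Rightarrow> real) \<Rightarrow> ('a \<Rightarrow> real) \<Rightarrow> ('a \<Rightarrow> real) \<Rightarrow> bool" where
  "spectral_overlap \<rho> \<sigma> w p q \<longleftrightarrow>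
     (\<forall>i j. 0 \<le> w i j) \<and> (\<forall>i. 0 \<le> p i) \<and> (\<forall>j. 0 \<le> q j)
     \<and> (\<forall>i. (\<Sum>j\<in>UNIV. w i j) = 1) \<and> (\<forall>j. (\<Sum>i\<in>UNIV. w i j) = 1)
     \<and> (\<Sum>i\<in>UNIV. p i) = 1 \<and> (\<Sum>j\<in>UNIV. q j) = 1
     \<and> (\<forall>i j. q j = 0 \<longrightarrow> w i j * p i = 0)
     \<and> qrel \<rho> \<sigma> = (\<Sum>i\<in>UNIV. \<Sum>j\<in>UNIV. w i j * p i * (ln (p i) - ln (q j)))
     \<and> (\<forall>t>0. (\<forall>X. resolvent_obj t \<rho> \<sigma> X \<le> (\<Sum>i\<in>UNIV. \<Sum>j\<in>UNIV. w i j * ((p i)\<^sup>2 / (q j + t * p i))))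
          \<and> (\<exists>X. resolvent_obj t \<rho> \<sigma> X = (\<Sum>i\<in>UNIV. \<Sum>j\<in>UNIV. w i j * ((p i)\<^sup>2 / (q j + t * p i)))))"

text \<open>Both matrices are diagonalised separately, and the unitary comparing the two eigenbases
  supplies the weights. Everything later about relative entropy is read off from these scalar
  data.\<close>

lemma spectral_overlap_exists:
  fixes \<rho> \<sigma> :: "complex^'a::finite^'a"
  assumes \<rho>: "\<rho> \<in> density" and \<sigma>: "\<sigma> \<in> density" and supp: "qsupp_sub \<rho> \<sigma>"
  shows "\<exists>w p q. spectral_overlap \<rho> \<sigma> w p q"
proof -
  obtain U p where U: "unitary_mat U" "\<rho> = U ** diagm p ** ctrans U" "\<And>i. 0 \<le> p i"
    using \<rho> psd_spectral by (auto simp: density_def)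
  obtain V q where V: "unitary_mat V" "\<sigma> = V ** diagm q ** ctrans V" "\<And>i. 0 \<le> q i"
    using \<sigma> psd_spectral by (auto simp: density_def)
  define W where "W = ctrans U ** V"
  define w where "w i j = (cmod (W $ i $ j))\<^sup>2" for i j
  have uW: "unitary_mat W"
    unfolding W_def using U V by (simp add: unitary_ctrans_mult)
  have sums: "(\<Sum>i\<in>UNIV. p i) = 1" "(\<Sum>j\<in>UNIV. q j) = 1"
    using \<rho> \<sigma> trace_spectral [OF U(1), of p] trace_spectral [OF V(1), of q]
    by (simp_all add: density_def flip: U(2) V(2) of_real_sum)
  have rows: "(\<Sum>j\<in>UNIV. w i j) = 1" for i
    unfolding w_def using uW by (rule unitary_row_sum)
  have cols: "(\<Sum>i\<in>UNIV. w i j) = 1" for j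
    unfolding w_def using uW by (rule unitary_column_sum)
  \<comment> \<open>Column \<open>j\<close> of \<open>V\<close> spans part of the kernel of
    \<sigma>, hence lies in the kernel of \<rho>; in the eigenbasis of \<rho> this says that
    \<open>p i * W $ i $ j\<close> vanishes. Thus the value \<open>ln 0 = 0\<close> is always
    multiplied by zero.\<close>
  have null: "w i j * p i = 0" if "q j = 0" for i j
  proof -
    let ?v = "V *v axis j 1"
    have "\<sigma> *v ?v = (V ** diagm q ** (ctrans V ** V)) *v axis j 1"
      by (simp add: V(2) matrix_vector_mul_assoc matrix_mul_assoc)
    also have "\<dots> = (V ** diagm q) *v axis j 1"
      using V(1) by (simp add: unitary_mat_def)
    also have "\<dots> = 0"
      using that by (simp add: vec_eq_iff matrix_vector_mult_axis mult_diagm_nth)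
    finally have "\<rho> *v ?v = 0" using supp by (simp add: qsupp_sub_def)
    then have "ctrans U *v (\<rho> *v ?v) = 0" by (simp add: matrix_vector_mult_0_right)
    moreover have "ctrans U *v (\<rho> *v ?v) = ((ctrans U ** U) ** (diagm p ** W)) *v axis j 1"
      by (simp add: U(2) W_def matrix_vector_mul_assoc matrix_mul_assoc)
    ultimately have "(diagm p ** W) *v axis j 1 = 0"
      using U(1) by (simp add: unitary_mat_def)
    then have "(diagm p ** W) $ i $ j = 0"
      by (simp add: vec_eq_iff matrix_vector_mult_axis)
    then show ?thesis by (auto simp: diagm_mult_nth w_def)
  qed
  have "trace (\<rho> ** mfun ln \<rho>) = trace (\<rho> ** (U ** diagm (ln \<circ> p) ** ctrans U))"
    using mfun_eq [OF U(1,2)] by simp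
  also have "\<dots> = trace (U ** (diagm p ** diagm (ln \<circ> p) ** ctrans U))"
  proof -
    have "\<rho> ** (U ** diagm (ln \<circ> p) ** ctrans U)
        = U ** diagm p ** (ctrans U ** U) ** diagm (ln \<circ> p) ** ctrans U"
      by (simp add: U(2) matrix_mul_assoc)
    also have "\<dots> = U ** (diagm p ** diagm (ln \<circ> p) ** ctrans U)"
      using U(1) by (simp add: unitary_mat_def) (simp add: matrix_mul_assoc)
    finally show ?thesis by simp
  qed
  also have "diagm p ** diagm (ln \<circ> p) = diagm (\<lambda>i. p i * ln (p i))"
    by (simp add: vec_eq_iff diagm_mult_nth diagm_nth)
  finally have "trace (\<rho> ** mfun ln \<rho>) = complex_of_real (\<Sum>i\<in>UNIV. p i * ln (p i))"
    using trace_spectral [OF U(1)] by (simp add: matrix_mul_assoc)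
  moreover have "trace (\<rho> ** mfun ln \<sigma>)
      = complex_of_real (\<Sum>i\<in>UNIV. \<Sum>j\<in>UNIV. w i j * (p i * ln (q j)))"
    unfolding mfun_eq [OF V(1,2)] U(2) trace_spectral_product by (simp add: w_def W_def)
  ultimately have "qrel \<rho> \<sigma> = (\<Sum>i\<in>UNIV. p i * ln (p i)) - (\<Sum>i\<in>UNIV. \<Sum>j\<in>UNIV. w i j * (p i * ln (q j)))"
    by (simp add: qrel_def matrix_diff_ldistrib trace_sub)
  \<comment> \<open>The unit row sums bring both logarithms under the same double sum.\<close>
  also have "(\<Sum>i\<in>UNIV. p i * ln (p i)) = (\<Sum>i\<in>UNIV. \<Sum>j\<in>UNIV. w i j * (p i * ln (p i)))"
    by (simp add: sum_distrib_right [symmetric] rows)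
  finally have qr: "qrel \<rho> \<sigma> = (\<Sum>i\<in>UNIV. \<Sum>j\<in>UNIV. w i j * p i * (ln (p i) - ln (q j)))"
    by (simp add: sum_subtractf [symmetric] algebra_simps)
  have p0: "p i = 0" if "t > 0" "q j + t * p i = 0" for t i j
  proof -
    have "0 \<le> t * p i" using U(3) that by simp
    then have "t * p i = 0" using V(3) [of j] that(2) by linarith
    then show ?thesis using that(1) by simp
  qed
  have "resolvent_obj t \<rho> \<sigma> X \<le> (\<Sum>i\<in>UNIV. \<Sum>j\<in>UNIV. w i j * ((p i)\<^sup>2 / (q j + t * p i)))"
    if t: "t > 0" for t X
  proof -
    define Y where "Y = ctrans V ** X ** U"
    have "X = (V ** ctrans V) ** X ** (U ** ctrans U)"
      using U V by (simp add: unitary_mat_def)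
    then have X: "X = V ** Y ** ctrans U"
      by (simp add: Y_def matrix_mul_assoc)
    show ?thesis
      unfolding X U(2) V(2) resolvent_obj_spectral [OF U(1) V(1)] W_def [symmetric] w_def
    proof (intro sum_mono quadratic_le_completed_square)
      fix i j
      show "0 \<le> q j + t * p i" using t U(3) V(3) by simp
      show "p i = 0" if "q j + t * p i = 0"
        using t that by (rule p0)
    qed
  qed
  moreover have "\<exists>X. resolvent_obj t \<rho> \<sigma> X = (\<Sum>i\<in>UNIV. \<Sum>j\<in>UNIV. w i j * ((p i)\<^sup>2 / (q j + t * p i)))"
    if t: "t > 0" for t
  proof
    \<comment> \<open>The entrywise maximiser, from the equality case of the completed
      square.\<close>
    define Y where "Y = (\<chi> j i. cnj (W $ i $ j) * complex_of_real (p i / (q j + t * p i)))"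
    show "resolvent_obj t \<rho> \<sigma> (V ** Y ** ctrans U)
        = (\<Sum>i\<in>UNIV. \<Sum>j\<in>UNIV. w i j * ((p i)\<^sup>2 / (q j + t * p i)))"
      unfolding U(2) V(2) resolvent_obj_spectral [OF U(1) V(1)] W_def [symmetric] w_def
    proof (intro sum.cong refl quadratic_le_completed_square)
      fix i j
      show "0 \<le> q j + t * p i" using t U(3) V(3) by simp
      show "p i = 0" if "q j + t * p i = 0"
        using t that by (rule p0)
      show "Y $ j $ i = cnj (W $ i $ j) * complex_of_real (p i / (q j + t * p i))"
        by (simp add: Y_def)
    qed
  qed
  ultimately have "spectral_overlap \<rho> \<sigma> w p q"
    unfolding spectral_overlap_def using U(3) V(3) rows cols sums null qr
    by (auto simp: w_def)
  then show ?thesis by blast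
qed

section \<open>Kraus maps, their duals and the behaviour of supports\<close>

definition kraus :: "('k::finite \<Rightarrow> complex^'a::finite^'b::finite) \<Rightarrow> complex^'a^'a \<Rightarrow> complex^'b^'b" where
  "kraus K \<rho> = (\<Sum>k\<in>UNIV. K k ** \<rho> ** ctrans (K k))"

definition kraus_dual :: "('k::finite \<Rightarrow> complex^'a::finite^'b::finite) \<Rightarrow> complex^'b^'b \<Rightarrow> complex^'a^'a" where
  "kraus_dual K X = (\<Sum>k\<in>UNIV. ctrans (K k) ** X ** K k)"

definition kraus_complete :: "('k::finite \<Rightarrow> complex^'a::finite^'b::finite) \<Rightarrow> bool" where
  "kraus_complete K \<longleftrightarrow> (\<Sum>k\<in>UNIV. ctrans (K k) ** K k) = mat 1"

lemma trace_mult_kraus: "trace (X ** kraus K \<rho>) = trace (kraus_dual K X ** \<rho>)"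
proof -
  have "trace (X ** (K k ** \<rho> ** ctrans (K k))) = trace (ctrans (K k) ** X ** K k ** \<rho>)" for k
    using trace_mul_sym [of "X ** K k ** \<rho>" "ctrans (K k)"] by (simp add: matrix_mul_assoc)
  then show ?thesis
    by (simp add: kraus_def kraus_dual_def matrix_sum_ldistrib matrix_sum_rdistrib trace_sum)
qed

lemma ctrans_kraus_dual: "ctrans (kraus_dual K X) = kraus_dual K (ctrans X)"
  by (simp add: kraus_dual_def ctrans_sum ctrans_mult matrix_mul_assoc)

lemma kraus_dual_mat_1: "kraus_complete K \<Longrightarrow> kraus_dual K (mat 1) = mat 1"
  by (simp add: kraus_dual_def kraus_complete_def)

lemma trace_kraus: "kraus_complete K \<Longrightarrow> trace (kraus K \<rho>) = trace \<rho>"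
  using trace_mult_kraus [of "mat 1" K \<rho>] by (simp add: kraus_dual_mat_1)

text \<open>The Kadison--Schwarz inequality: with \<open>Y\<^sub>k = X\<^sup>* K\<^sub>k - K\<^sub>k D\<^sup>*\<close> one has
  \<open>\<Sum>\<^sub>k Y\<^sub>k\<^sup>* Y\<^sub>k = M\<^sup>*(X X\<^sup>*) - D D\<^sup>*\<close>, where \<open>D = M\<^sup>*(X)\<close>.\<close>
lemma kraus_schwarz:
  assumes "kraus_complete K" "psd \<sigma>"
  shows "Re (trace (kraus_dual K X ** ctrans (kraus_dual K X) ** \<sigma>))
     \<le> Re (trace (X ** ctrans X ** kraus K \<sigma>))"
proof -
  define D where "D = kraus_dual K X"
  define Y where "Y k = ctrans X ** K k - K k ** ctrans D" for k
  have YY: "ctrans (Y k) ** Y k = ctrans (K k) ** (X ** ctrans X) ** K k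
      - (ctrans (K k) ** X ** K k) ** ctrans D
      - (D ** (ctrans (K k) ** ctrans X ** K k) - D ** (ctrans (K k) ** K k) ** ctrans D)" for k
    by (simp add: Y_def ctrans_diff ctrans_mult matrix_diff_ldistrib matrix_diff_rdistrib matrix_mul_assoc)
  have "(\<Sum>k\<in>UNIV. ctrans (Y k) ** Y k) = kraus_dual K (X ** ctrans X) - kraus_dual K X ** ctrans D
     - (D ** kraus_dual K (ctrans X) - D ** (\<Sum>k\<in>UNIV. ctrans (K k) ** K k) ** ctrans D)"
    unfolding YY kraus_dual_def sum_subtractf matrix_sum_ldistrib matrix_sum_rdistrib ..
  also have "\<dots> = kraus_dual K (X ** ctrans X) - D ** ctrans D"
    using assms(1) by (simp add: kraus_complete_def D_def ctrans_kraus_dual)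
  finally have eq: "(\<Sum>k\<in>UNIV. ctrans (Y k) ** Y k) = kraus_dual K (X ** ctrans X) - D ** ctrans D" .
  have "0 \<le> Re (trace (\<Sum>k\<in>UNIV. Y k ** \<sigma> ** ctrans (Y k)))"
    using assms(2) by (intro Re_trace_psd_nonneg psd_sum psd_conj)
  also have "trace (\<Sum>k\<in>UNIV. Y k ** \<sigma> ** ctrans (Y k)) = trace ((\<Sum>k\<in>UNIV. ctrans (Y k) ** Y k) ** \<sigma>)"
    unfolding trace_sum matrix_sum_rdistrib
    by (intro sum.cong refl) (subst trace_mul_sym, simp add: matrix_mul_assoc)
  also have "\<dots> = trace (X ** ctrans X ** kraus K \<sigma>) - trace (D ** ctrans D ** \<sigma>)"
    by (simp add: eq matrix_diff_rdistrib trace_sub trace_mult_kraus)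
  finally show ?thesis by (simp add: D_def)
qed

lemma psd_kraus: "psd \<rho> \<Longrightarrow> psd (kraus K \<rho>)"
  unfolding kraus_def by (intro psd_sum psd_conj)

lemma density_kraus: "kraus_complete K \<Longrightarrow> \<rho> \<in> density \<Longrightarrow> kraus K \<rho> \<in> density"
  by (simp add: density_def psd_kraus trace_kraus)

lemma qform_sum: "qform (\<Sum>k\<in>S. A k) v = (\<Sum>k\<in>S. qform (A k) v)"
  by (induction S rule: infinite_finite_induct) (simp_all add: qform_zero qform_add)

lemma qform_kraus: "qform (kraus K \<rho>) v = (\<Sum>k\<in>UNIV. qform \<rho> (ctrans (K k) *v v))"
  by (simp add: kraus_def qform_sum qform_conj)

text \<open>The form of the output is a sum of input forms at \<open>ctrans (K k) *v v\<close>. If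
  the sum for \<sigma> is zero, all these vectors lie in the kernel of \<sigma>, hence in that of
  \<rho>.\<close>

lemma qsupp_sub_kraus:
  assumes "psd \<rho>" "psd \<sigma>" "qsupp_sub \<rho> \<sigma>"
  shows "qsupp_sub (kraus K \<rho>) (kraus K \<sigma>)"
  unfolding qsupp_sub_def
proof (intro allI impI)
  fix v assume "kraus K \<sigma> *v v = 0"
  then have "qform (kraus K \<sigma>) v = 0"
    by (simp add: qform_eq_cinner cinner_zero_right)
  then have "(\<Sum>k\<in>UNIV. Re (qform \<sigma> (ctrans (K k) *v v))) = 0"
    by (metis Re_sum qform_kraus zero_complex.sel(1))
  then have "Re (qform \<sigma> (ctrans (K k) *v v)) = 0" for k
    using assms(2) by (subst (asm) sum_nonneg_eq_0_iff) (auto simp: psd_def)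
  then have "\<sigma> *v (ctrans (K k) *v v) = 0" for k
    by (intro psd_qform_0_imp_null assms(2))
  then have "\<rho> *v (ctrans (K k) *v v) = 0" for k
    using assms(3) unfolding qsupp_sub_def by blast
  then have "Re (qform (kraus K \<rho>) v) = 0"
    by (simp add: qform_kraus qform_eq_cinner [of \<rho>] cinner_zero_right)
  then show "kraus K \<rho> *v v = 0"
    using assms(1) psd_kraus psd_qform_0_imp_null by blast
qed

text \<open>The linear term is carried over exactly by duality. The two subtracted quadratic terms
  can only decrease, by Kadison-Schwarz for \<open>X\<close> with \<sigma> and for
  \<open>ctrans X\<close> with \<rho>.\<close>

lemma resolvent_obj_kraus:
  assumes "kraus_complete K" "psd \<rho>" "psd \<sigma>" "0 \<le> t"
  shows "resolvent_obj t (kraus K \<rho>) (kraus K \<sigma>) X \<le> resolvent_obj t \<rho> \<sigma> (kraus_dual K X)"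
proof -
  have "trace (ctrans X ** kraus K \<rho>) = trace (ctrans (kraus_dual K X) ** \<rho>)"
    by (simp add: trace_mult_kraus ctrans_kraus_dual)
  moreover have "Re (trace (kraus_dual K X ** ctrans (kraus_dual K X) ** \<sigma>))
      \<le> Re (trace (X ** ctrans X ** kraus K \<sigma>))"
    using assms by (intro kraus_schwarz)
  moreover have "t * Re (trace (ctrans (kraus_dual K X) ** kraus_dual K X ** \<rho>))
      \<le> t * Re (trace (ctrans X ** X ** kraus K \<rho>))"
    using assms kraus_schwarz [of K \<rho> "ctrans X"]
    by (intro mult_left_mono) (simp_all add: ctrans_kraus_dual flip: ctrans_kraus_dual)
  ultimately show ?thesis by (simp add: resolvent_obj_def)
qed

section \<open>The integral formula for relative entropy and monotonicity\<close>

definition log_primitive :: "('a::finite \<Rightarrow> 'a \<Rightarrow> real) \<Rightarrow> ('a \<Rightarrow> real) \<Rightarrow> ('a \<Rightarrow> real) \<Rightarrow> real \<Rightarrow> real" where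
  "log_primitive w p q t = (\<Sum>i\<in>UNIV. \<Sum>j\<in>UNIV. w i j * p i * (ln (q j + t * p i) - ln (q j)))"

text \<open>\<open>log_primitive\<close> is the antiderivative of the resolvent value that vanishes
  at 0; through it the integral formula is used by way of derivatives and a limit. Terms with
  nonzero weight have \<open>q j > 0\<close>, so the logarithm is differentiable there, also at
  \<open>t = 0\<close>.\<close>

lemma DERIV_log_primitive:
  assumes "spectral_overlap \<rho> \<sigma> w p q" "0 \<le> t"
  shows "(log_primitive w p q has_real_derivative
      (\<Sum>i\<in>UNIV. \<Sum>j\<in>UNIV. w i j * ((p i)\<^sup>2 / (q j + t * p i)))) (at t)"
  unfolding log_primitive_def
proof (intro DERIV_sum)
  fix i j
  show "((\<lambda>t. w i j * p i * (ln (q j + t * p i) - ln (q j))) has_real_derivative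
      w i j * ((p i)\<^sup>2 / (q j + t * p i))) (at t)"
  proof (cases "w i j * p i = 0")
    case True
    then show ?thesis by auto
  next
    case False
    have "0 \<le> q j" "0 \<le> p i" "q j \<noteq> 0"
      using assms(1) False by (auto simp: spectral_overlap_def)
    then have "0 < q j + t * p i"
      using assms(2) by (simp add: add_pos_nonneg)
    then show ?thesis
      by (auto intro!: derivative_eq_intros simp: power2_eq_square)
  qed
qed

text \<open>The counterterm \<open>ln (1 + t)\<close> integrates the part \<open>p / (1 + t)\<close>
  of the formula. The weights \<open>w i j * p i\<close> sum to 1, so it can be distributed over the
  terms, and each limit comes from \<open>(q + t p) / (1 + t)\<close> tending to
  \<open>p\<close>.\<close>

lemma log_primitive_tendsto_qrel:
  assumes so: "spectral_overlap \<rho> \<sigma> w p q"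
  shows "((\<lambda>t. log_primitive w p q t - ln (1 + t)) \<longlongrightarrow> qrel \<rho> \<sigma>) at_top"
proof -
  have "(\<Sum>i\<in>UNIV. \<Sum>j\<in>UNIV. w i j * p i) = 1"
    using so by (simp add: spectral_overlap_def sum_distrib_right [symmetric])
  then have L: "ln (1 + t) = (\<Sum>i\<in>UNIV. \<Sum>j\<in>UNIV. w i j * p i * ln (1 + t))" for t :: real
    by (simp add: sum_distrib_right [symmetric])
  have eq: "log_primitive w p q t - ln (1 + t)
     = (\<Sum>i\<in>UNIV. \<Sum>j\<in>UNIV. w i j * p i * (ln (q j + t * p i) - ln (q j) - ln (1 + t)))" for t
  proof -
    have "log_primitive w p q t - ln (1 + t)
        = log_primitive w p q t - (\<Sum>i\<in>UNIV. \<Sum>j\<in>UNIV. w i j * p i * ln (1 + t))"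
      using L [of t] by (rule arg_cong)
    then show ?thesis by (simp only: log_primitive_def sum_subtractf right_diff_distrib)
  qed
  have qr: "qrel \<rho> \<sigma> = (\<Sum>i\<in>UNIV. \<Sum>j\<in>UNIV. w i j * p i * (ln (p i) - ln (q j)))"
    using so by (simp add: spectral_overlap_def)
  show ?thesis
    unfolding eq qr
  proof (intro tendsto_sum)
    fix i j
    show "((\<lambda>t. w i j * p i * (ln (q j + t * p i) - ln (q j) - ln (1 + t)))
        \<longlongrightarrow> w i j * p i * (ln (p i) - ln (q j))) at_top"
    proof (cases "w i j * p i = 0")
      case False
      have nn: "0 \<le> q j" "0 \<le> p i"
        using so by (auto simp: spectral_overlap_def)
      have pos: "0 < p i" using False nn by (cases "p i = 0") auto
      have "((\<lambda>t. ln ((q j - p i) * inverse (1 + t) + p i)) \<longlongrightarrow> ln ((q j - p i) * 0 + p i)) at_top"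
        using pos
        by (intro tendsto_intros tendsto_inverse_0_at_top filterlim_tendsto_add_at_top [OF tendsto_const]
            filterlim_ident) auto
      moreover have "\<forall>\<^sub>F t in at_top. ln ((q j - p i) * inverse (1 + t) + p i) = ln (q j + t * p i) - ln (1 + t)"
        using eventually_gt_at_top [of 0]
      proof eventually_elim
        case (elim t)
        then have "0 < q j + t * p i" using nn pos by (simp add: add_nonneg_pos)
        then have "ln (q j + t * p i) - ln (1 + t) = ln ((q j + t * p i) / (1 + t))"
          using elim by (simp add: ln_div)
        also have "(q j + t * p i) / (1 + t) = (q j - p i) * inverse (1 + t) + p i"
          using elim by (simp add: field_simps)
        finally show ?case ..
      qed
      ultimately have "((\<lambda>t. ln (q j + t * p i) - ln (1 + t)) \<longlongrightarrow> ln (p i)) at_top"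
        using tendsto_cong by fastforce
      then have "((\<lambda>t. w i j * p i * ((ln (q j + t * p i) - ln (1 + t)) - ln (q j)))
        \<longlongrightarrow> w i j * p i * (ln (p i) - ln (q j))) at_top"
        by (intro tendsto_intros)
      then show ?thesis by (simp add: algebra_simps)
    qed (simp only: mult_zero_left tendsto_const)
  qed
qed

text \<open>Klein's inequality, termwise from \<open>p (ln p - ln q) \<ge> p - q\<close>: double
  stochasticity of \<open>w\<close> makes the weighted sums of \<open>p\<close> and of
  \<open>q\<close> both equal to 1, so the lower bounds add up to 0.\<close>

lemma qrel_nonneg:
  assumes "\<rho> \<in> density" "\<sigma> \<in> density" "qsupp_sub \<rho> \<sigma>"
  shows "0 \<le> qrel \<rho> \<sigma>"
proof -
  obtain w p q where so: "spectral_overlap \<rho> \<sigma> w p q"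
    using spectral_overlap_exists [OF assms] by blast
  have "(\<Sum>i\<in>UNIV. \<Sum>j\<in>UNIV. w i j * q j) = (\<Sum>j\<in>UNIV. \<Sum>i\<in>UNIV. w i j * q j)"
    by (rule sum.swap)
  also have "\<dots> = 1" using so by (simp add: spectral_overlap_def sum_distrib_right [symmetric])
  finally have "0 = (\<Sum>i\<in>UNIV. \<Sum>j\<in>UNIV. w i j * p i) - (\<Sum>i\<in>UNIV. \<Sum>j\<in>UNIV. w i j * q j)"
    using so by (simp add: spectral_overlap_def sum_distrib_right [symmetric])
  also have "\<dots> = (\<Sum>i\<in>UNIV. \<Sum>j\<in>UNIV. w i j * p i - w i j * q j)"
    by (simp add: sum_subtractf)
  also have "\<dots> \<le> (\<Sum>i\<in>UNIV. \<Sum>j\<in>UNIV. w i j * p i * (ln (p i) - ln (q j)))"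
  proof (intro sum_mono)
    fix i j
    have nn: "0 \<le> w i j" "0 \<le> q j" "0 \<le> p i" "q j = 0 \<Longrightarrow> w i j * p i = 0"
      using so by (auto simp: spectral_overlap_def)
    show "w i j * p i - w i j * q j \<le> w i j * p i * (ln (p i) - ln (q j))"
    proof (cases "w i j * p i = 0")
      case True
      then show ?thesis using nn(1-3) by auto
    next
      case False
      then have pos: "0 < p i" "0 < q j" using nn by (auto simp: less_le)
      have "ln (q j / p i) \<le> q j / p i - 1"
        using pos by (intro ln_le_minus_one) simp
      then have "1 - q j / p i \<le> ln (p i) - ln (q j)"
        using pos by (simp add: ln_div)
      then have "w i j * p i * (1 - q j / p i) \<le> w i j * p i * (ln (p i) - ln (q j))"
        using nn by (intro mult_left_mono) simp_all
      then show ?thesis using pos by (simp add: right_diff_distrib)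
    qed
  qed
  also have "\<dots> = qrel \<rho> \<sigma>" using so by (simp add: spectral_overlap_def)
  finally show ?thesis .
qed

text \<open>The resolvent values compare for every \<open>t > 0\<close>. They are the derivatives of
  the two primitives, which both start at 0, so the primitives compare too, and the limit at
  infinity gives the relative entropies.\<close>

theorem qrel_kraus_le:
  fixes K :: "'k::finite \<Rightarrow> complex^'a::finite^'b::finite"
  assumes K: "kraus_complete K"
    and \<rho>: "\<rho> \<in> density" and \<sigma>: "\<sigma> \<in> density" and supp: "qsupp_sub \<rho> \<sigma>"
  shows "qrel (kraus K \<rho>) (kraus K \<sigma>) \<le> qrel \<rho> \<sigma>"
proof -
  obtain w p q where so: "spectral_overlap \<rho> \<sigma> w p q"
    using spectral_overlap_exists [OF \<rho> \<sigma> supp] by blast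
  obtain w' p' q' where so': "spectral_overlap (kraus K \<rho>) (kraus K \<sigma>) w' p' q'"
    using spectral_overlap_exists \<rho> \<sigma> supp K density_kraus qsupp_sub_kraus
    by (metis (mono_tags, lifting) density_def mem_Collect_eq)
  have le: "(\<Sum>i\<in>UNIV. \<Sum>j\<in>UNIV. w' i j * ((p' i)\<^sup>2 / (q' j + t * p' i)))
      \<le> (\<Sum>i\<in>UNIV. \<Sum>j\<in>UNIV. w i j * ((p i)\<^sup>2 / (q j + t * p i)))" if t: "t > 0" for t
  proof -
    \<comment> \<open>The optimal \<open>X\<close> for the outputs; its dual image is a competitor
      for the inputs.\<close>
    obtain X where X: "resolvent_obj t (kraus K \<rho>) (kraus K \<sigma>) X
        = (\<Sum>i\<in>UNIV. \<Sum>j\<in>UNIV. w' i j * ((p' i)\<^sup>2 / (q' j + t * p' i)))"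
      using so' t unfolding spectral_overlap_def by blast
    have "resolvent_obj t (kraus K \<rho>) (kraus K \<sigma>) X \<le> resolvent_obj t \<rho> \<sigma> (kraus_dual K X)"
      using K \<rho> \<sigma> t by (intro resolvent_obj_kraus) (auto simp: density_def)
    also have "\<dots> \<le> (\<Sum>i\<in>UNIV. \<Sum>j\<in>UNIV. w i j * ((p i)\<^sup>2 / (q j + t * p i)))"
      using so t unfolding spectral_overlap_def by blast
    finally show ?thesis by (simp only: X)
  qed
  have prim: "log_primitive w' p' q' t \<le> log_primitive w p q t" if "t > 0" for t
  proof -
    let ?h = "\<lambda>t. log_primitive w p q t - log_primitive w' p' q' t"
    have D: "(?h has_real_derivative (\<Sum>i\<in>UNIV. \<Sum>j\<in>UNIV. w i j * ((p i)\<^sup>2 / (q j + s * p i)))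
        - (\<Sum>i\<in>UNIV. \<Sum>j\<in>UNIV. w' i j * ((p' i)\<^sup>2 / (q' j + s * p' i)))) (at s)" if "0 \<le> s" for s
      by (intro DERIV_diff DERIV_log_primitive [OF so that] DERIV_log_primitive [OF so' that])
    have "?h 0 \<le> ?h t"
    proof (rule DERIV_nonneg_imp_increasing_open [where f = ?h])
      show "\<exists>y. (?h has_real_derivative y) (at s) \<and> 0 \<le> y" if "0 < s" "s < t" for s
        using D [of s] le [of s] that by fastforce
      show "continuous_on {0..t} ?h"
        using D by (intro DERIV_atLeastAtMost_imp_continuous_on) blast
    qed (use that in simp)
    then show ?thesis by (simp add: log_primitive_def)
  qed
  show ?thesis
  proof (rule tendsto_le [OF _ log_primitive_tendsto_qrel [OF so] log_primitive_tendsto_qrel [OF so']])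
    show "\<forall>\<^sub>F t in at_top. log_primitive w' p' q' t - ln (1 + t) \<le> log_primitive w p q t - ln (1 + t)"
      using eventually_gt_at_top [of 0] by eventually_elim (simp add: prim)
  qed simp
qed

section \<open>Channels and contraction coefficients\<close>

lemma cscale_nth: "cscale c A $ i $ j = c * A $ i $ j"
  by (simp add: cscale_def)

lemma ketbra_nth: "ketbra i j $ k $ l = (if k = i \<and> l = j then 1 else 0)"
  by (simp add: ketbra_def)

lemma matrix_ketbra_expansion: "A = (\<Sum>i\<in>UNIV. \<Sum>j\<in>UNIV. cscale (A $ i $ j) (ketbra i j))"
proof -
  have "(\<Sum>i\<in>UNIV. \<Sum>j\<in>UNIV. cscale (A $ i $ j) (ketbra i j)) $ k $ l = A $ k $ l" for k l
  proof -
    have "(\<Sum>j\<in>UNIV. A $ i $ j * ketbra i j $ k $ l) = (if i = k then A $ k $ l else 0)" for i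
      by (simp add: ketbra_nth if_distrib [where f = "\<lambda>x. _ * x"] cong: if_cong)
    then show ?thesis by (simp add: cscale_nth)
  qed
  then show ?thesis by (simp add: vec_eq_iff)
qed

lemma matrix_eqI_trace:
  assumes "\<And>B. trace (A ** B) = trace (C ** B)"
  shows "A = (C :: complex^'a::finite^'a)"
proof -
  have "trace (D ** ketbra j i) = D $ i $ j" for D :: "complex^'a^'a" and i j
  proof -
    have "(\<Sum>l\<in>UNIV. D $ k $ l * ketbra j i $ l $ k) = (if k = i then D $ i $ j else 0)" for k
      by (simp add: ketbra_nth if_distrib [where f = "\<lambda>x. _ * x"] cong: if_cong)
    then show ?thesis by (simp add: trace_def matrix_mult_nth)
  qed
  then show ?thesis by (metis (no_types) assms vec_eq_iff)
qed

lemma qchannel_sum: "qchannel M \<Longrightarrow> M (\<Sum>k\<in>S. A k) = (\<Sum>k\<in>S. M (A k))"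
proof (induction S rule: infinite_finite_induct)
  case empty
  have "M (0 + 0) = M 0 + M 0" using empty unfolding qchannel_def by blast
  then show ?case by simp
next
  case (infinite A)
  have "M (0 + 0) = M 0 + M 0" using infinite unfolding qchannel_def by blast
  with infinite show ?case by simp
next
  case (insert x F)
  then show ?case unfolding qchannel_def by simp
qed

lemma scaleR_eq_cscale: "r *\<^sub>R B = cscale (complex_of_real r) B"
  by (simp add: vec_eq_iff cscale_nth) (simp add: scaleR_conv_of_real)

lemma qchannel_scaleR: "qchannel M \<Longrightarrow> M (r *\<^sub>R A) = r *\<^sub>R M A"
  unfolding qchannel_def scaleR_eq_cscale by simp

text \<open>Choi's theorem: linearity determines the map by its values on matrix units, which are
  the blocks of the Choi matrix, and a spectral decomposition of that matrix writes them as a sum of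
  Kraus terms.\<close>

lemma qchannel_kraus:
  fixes M :: "complex^'a::finite^'a \<Rightarrow> complex^'b::finite^'b"
  assumes M: "qchannel M"
  shows "\<exists>K :: 'a \<times> 'b \<Rightarrow> complex^'a^'b. kraus_complete K \<and> M = kraus K"
proof -
  have "psd (choi M)" using M by (simp add: qchannel_def)
  then obtain V :: "complex^('a \<times> 'b)^('a \<times> 'b)" and d :: "'a \<times> 'b \<Rightarrow> real"
    where V: "choi M = V ** diagm d ** ctrans V" and d: "\<And>k. 0 \<le> d k"
    using psd_spectral by blast
  \<comment> \<open>Eigenvectors of the Choi matrix, reshaped into matrices and scaled by the square
    roots of their nonnegative eigenvalues.\<close>
  define K :: "'a \<times> 'b \<Rightarrow> complex^'a^'b"
    where "K k = (\<chi> b a. complex_of_real (sqrt (d k)) * V $ (a, b) $ k)" for k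
  have KK: "(\<Sum>k\<in>UNIV. K k $ b $ a * cnj (K k $ b' $ a')) = M (ketbra a a') $ b $ b'" for a a' b b'
  proof -
    have "M (ketbra a a') $ b $ b' = choi M $ (a, b) $ (a', b')" by (simp add: choi_def)
    also have "\<dots> = (\<Sum>k\<in>UNIV. V $ (a, b) $ k * complex_of_real (d k) * cnj (V $ (a', b') $ k))"
      by (simp add: V matrix_mult_nth [of "V ** diagm d"] mult_diagm_nth)
    also have "\<dots> = (\<Sum>k\<in>UNIV. K k $ b $ a * cnj (K k $ b' $ a'))"
    proof (rule sum.cong [OF refl])
      fix k
      have "complex_of_real (d k) = complex_of_real (sqrt (d k)) * complex_of_real (sqrt (d k))"
        using d [of k] by (simp flip: of_real_mult)
      then show "V $ (a, b) $ k * complex_of_real (d k) * cnj (V $ (a', b') $ k)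
          = K k $ b $ a * cnj (K k $ b' $ a')"
        by (simp add: K_def)
    qed
    finally show ?thesis ..
  qed
  have "M A = kraus K A" for A
  proof -
    have "M A $ b $ b' = kraus K A $ b $ b'" for b b'
    proof -
      have "M A = (\<Sum>i\<in>UNIV. \<Sum>j\<in>UNIV. M (cscale (A $ i $ j) (ketbra i j)))"
        by (subst matrix_ketbra_expansion [of A]) (simp only: qchannel_sum [OF M])
      also have "\<dots> = (\<Sum>i\<in>UNIV. \<Sum>j\<in>UNIV. cscale (A $ i $ j) (M (ketbra i j)))"
        using M unfolding qchannel_def by simp
      finally have "M A $ b $ b'
          = (\<Sum>i\<in>UNIV. \<Sum>j\<in>UNIV. \<Sum>k\<in>UNIV. A $ i $ j * (K k $ b $ i * cnj (K k $ b' $ j)))"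
        by (simp add: cscale_nth sum_distrib_left flip: KK)
      also have "\<dots> = (\<Sum>i\<in>UNIV. \<Sum>k\<in>UNIV. \<Sum>j\<in>UNIV. A $ i $ j * (K k $ b $ i * cnj (K k $ b' $ j)))"
        by (intro sum.cong refl sum.swap)
      also have "\<dots> = (\<Sum>k\<in>UNIV. \<Sum>i\<in>UNIV. \<Sum>j\<in>UNIV. A $ i $ j * (K k $ b $ i * cnj (K k $ b' $ j)))"
        by (rule sum.swap)
      also have "\<dots> = (\<Sum>k\<in>UNIV. \<Sum>j\<in>UNIV. \<Sum>i\<in>UNIV. A $ i $ j * (K k $ b $ i * cnj (K k $ b' $ j)))"
        by (intro sum.cong refl sum.swap)
      also have "\<dots> = kraus K A $ b $ b'"
        by (simp add: kraus_def matrix_mult_nth sum_distrib_right sum_distrib_left mult_ac)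
      finally show ?thesis .
    qed
    then show ?thesis by (simp add: vec_eq_iff)
  qed
  then have MK: "M = kraus K" by blast
  \<comment> \<open>Trace preservation says that \<open>kraus_dual K (mat 1)\<close> and
    \<open>mat 1\<close> have the same trace pairing with every matrix.\<close>
  have "kraus_dual K (mat 1) = mat 1"
  proof (rule matrix_eqI_trace)
    fix B
    have "trace (kraus_dual K (mat 1) ** B) = trace (M B)"
      using trace_mult_kraus [of "mat 1" K B] by (simp add: MK)
    also have "\<dots> = trace (mat 1 ** B)" using M unfolding qchannel_def by simp
    finally show "trace (kraus_dual K (mat 1) ** B) = trace (mat 1 ** B)" .
  qed
  then have "kraus_complete K" by (simp add: kraus_dual_def kraus_complete_def)
  with MK show ?thesis by blast
qed

text \<open>Tracing out \<open>'b\<close> makes the blocks of \<open>U\<close> with fixed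
  \<open>b\<close> the Kraus operators; their completeness relation is the isometry condition on
  \<open>U\<close>.\<close>

lemma complementary_kraus:
  fixes U :: "complex^'a::finite^('b::finite \<times> 'e::finite)"
  assumes "isometry U"
  shows "\<exists>K :: 'b \<Rightarrow> complex^'a^'e. kraus_complete K \<and> (\<lambda>\<rho>. ptrace_B (U ** \<rho> ** ctrans U)) = kraus K"
proof -
  define K :: "'b \<Rightarrow> complex^'a^'e" where "K b = (\<chi> e a. U $ (b, e) $ a)" for b
  have "ptrace_B (U ** \<rho> ** ctrans U) = kraus K \<rho>" for \<rho>
    by (simp add: vec_eq_iff ptrace_B_def kraus_def matrix_mult_nth K_def)
  moreover have "kraus_complete K"
  proof -
    have "(\<Sum>b\<in>UNIV. ctrans (K b) ** K b) $ i $ j = (ctrans U ** U) $ i $ j" for i j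
    proof -
      have "(\<Sum>b\<in>UNIV. ctrans (K b) ** K b) $ i $ j
          = (\<Sum>b\<in>UNIV. \<Sum>e\<in>UNIV. cnj (U $ (b, e) $ i) * U $ (b, e) $ j)"
        by (simp add: matrix_mult_nth K_def)
      also have "\<dots> = (\<Sum>x\<in>UNIV. cnj (U $ x $ i) * U $ x $ j)"
        by (simp add: sum.cartesian_product flip: UNIV_Times_UNIV)
      finally show ?thesis by (simp add: matrix_mult_nth)
    qed
    then show ?thesis
      using assms by (simp add: kraus_complete_def isometry_def vec_eq_iff)
  qed
  ultimately show ?thesis by blast
qed

text \<open>A common interface for channels, their composition and the complementary map. It passes
  to compositions directly, without forming a Choi matrix or Kraus family for
  \<open>N \<circ> E\<close>.\<close>

definition entropy_monotone :: "(complex^'a::finite^'a \<Rightarrow> complex^'b::finite^'b) \<Rightarrow> bool" where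
  "entropy_monotone M \<longleftrightarrow> (\<forall>\<rho>\<in>density. \<forall>\<sigma>\<in>density. qsupp_sub \<rho> \<sigma> \<longrightarrow>
     M \<rho> \<in> density \<and> M \<sigma> \<in> density \<and> qsupp_sub (M \<rho>) (M \<sigma>) \<and> qrel (M \<rho>) (M \<sigma>) \<le> qrel \<rho> \<sigma>)"

lemma entropy_monotone_kraus:
  fixes K :: "'k::finite \<Rightarrow> complex^'a::finite^'b::finite"
  assumes "kraus_complete K"
  shows "entropy_monotone (kraus K)"
  unfolding entropy_monotone_def
proof (intro ballI impI conjI)
  fix \<rho> \<sigma> :: "complex^'a^'a"
  assume a: "\<rho> \<in> density" "\<sigma> \<in> density" "qsupp_sub \<rho> \<sigma>"
  then show "qsupp_sub (kraus K \<rho>) (kraus K \<sigma>)"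
    by (intro qsupp_sub_kraus) (auto simp: density_def)
qed (simp_all add: density_kraus qrel_kraus_le assms)

lemma entropy_monotone_qchannel: "qchannel M \<Longrightarrow> entropy_monotone M"
  using qchannel_kraus entropy_monotone_kraus by blast

lemma entropy_monotone_comp:
  assumes "entropy_monotone M" "entropy_monotone N"
  shows "entropy_monotone (M \<circ> N)"
  using assms unfolding entropy_monotone_def comp_def by (meson order_trans)

text \<open>Monotonicity confines the ratios to \<open>[0, 1]\<close>, so \<open>Sup\<close> and
  \<open>Inf\<close> are genuine bounds. The product form also covers pairs with zero relative
  entropy.\<close>

lemma qratio_bounds:
  assumes M: "entropy_monotone M"
    and a: "\<rho> \<in> density" "\<sigma> \<in> density" "qsupp_sub \<rho> \<sigma>"
  shows "etaQ M * qrel \<rho> \<sigma> \<le> qrel (M \<rho>) (M \<sigma>)" "qrel (M \<rho>) (M \<sigma>) \<le> zetaQ M * qrel \<rho> \<sigma>"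
proof -
  have nn: "0 \<le> qrel \<rho> \<sigma>" "0 \<le> qrel (M \<rho>) (M \<sigma>)" "qrel (M \<rho>) (M \<sigma>) \<le> qrel \<rho> \<sigma>"
    if "\<rho> \<in> density" "\<sigma> \<in> density" "qsupp_sub \<rho> \<sigma>" for \<rho> \<sigma>
    using that M qrel_nonneg unfolding entropy_monotone_def by blast+
  have bounds: "0 \<le> x \<and> x \<le> 1" if x: "x \<in> qratios M" for x
  proof -
    obtain \<rho> \<sigma> where "x = qrel (M \<rho>) (M \<sigma>) / qrel \<rho> \<sigma>" "\<rho> \<in> density" "\<sigma> \<in> density" "qsupp_sub \<rho> \<sigma>"
      using x unfolding qratios_def by blast
    then show ?thesis using nn [of \<rho> \<sigma>] by (auto simp: divide_le_eq_1)
  qed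
  then have bdd: "bdd_above (qratios M)" "bdd_below (qratios M)"
    unfolding bdd_above_def bdd_below_def by blast+
  have "etaQ M * qrel \<rho> \<sigma> \<le> qrel (M \<rho>) (M \<sigma>) \<and> qrel (M \<rho>) (M \<sigma>) \<le> zetaQ M * qrel \<rho> \<sigma>"
  proof (cases "qrel \<rho> \<sigma> = 0")
    case True
    \<comment> \<open>The output relative entropy lies between 0 and that of the input, so it is 0
      too.\<close>
    then show ?thesis using nn [OF a] by simp
  next
    case False
    then have pos: "0 < qrel \<rho> \<sigma>" using nn(1) [OF a] by simp
    have "\<rho> \<noteq> \<sigma>" using False by (auto simp: qrel_def trace_def)
    then have "qrel (M \<rho>) (M \<sigma>) / qrel \<rho> \<sigma> \<in> qratios M"
      using a unfolding qratios_def by blast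
    then have "etaQ M \<le> qrel (M \<rho>) (M \<sigma>) / qrel \<rho> \<sigma>" "qrel (M \<rho>) (M \<sigma>) / qrel \<rho> \<sigma> \<le> zetaQ M"
      unfolding etaQ_def zetaQ_def using bdd by (auto intro: cInf_lower cSup_upper)
    then show ?thesis using pos by (simp add: le_divide_eq divide_le_eq)
  qed
  then show "etaQ M * qrel \<rho> \<sigma> \<le> qrel (M \<rho>) (M \<sigma>)" "qrel (M \<rho>) (M \<sigma>) \<le> zetaQ M * qrel \<rho> \<sigma>"
    by auto
qed

section \<open>Jensen gaps of the von Neumann entropy\<close>

lemma vN_jensen_gap:
  assumes "z = (1 - t) *\<^sub>R x + t *\<^sub>R y"
  shows "vN z - (1 - t) * vN x - t * vN y = (1 - t) * qrel x z + t * qrel y z"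
proof -
  \<comment> \<open>Only the left factor is expanded: the logarithm stays at \<open>z\<close>, which
    produces the cross terms of the two relative entropies.\<close>
  have "trace (z ** mfun ln z) = (1 - t) *\<^sub>R trace (x ** mfun ln z) + t *\<^sub>R trace (y ** mfun ln z)"
    by (subst (1) assms)
      (simp add: matrix_add_rdistrib matrix_mult_scaleR_left trace_add trace_scaleR)
  then have "Re (trace (z ** mfun ln z)) = (1 - t) * Re (trace (x ** mfun ln z)) + t * Re (trace (y ** mfun ln z))"
    by simp
  then show ?thesis
    by (simp add: vN_def qrel_def matrix_diff_ldistrib trace_sub algebra_simps)
qed

lemma convex_density: "convex density"
  unfolding convex_def density_def
  by (auto simp: psd_add psd_scaleR trace_add trace_scaleR simp flip: scaleR_add_left)

text \<open>Both weights are strictly positive and both forms nonnegative, so the kernel of a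
  mixture is the intersection of the kernels.\<close>

lemma qsupp_sub_convex_comb:
  assumes "x \<in> density" "y \<in> density" "0 < t" "t < 1" and z: "z = (1 - t) *\<^sub>R x + t *\<^sub>R y"
  shows "qsupp_sub x z" "qsupp_sub y z"
proof -
  have "x *v v = 0 \<and> y *v v = 0" if "z *v v = 0" for v
  proof -
    have "qform z v = 0"
      using that by (simp add: qform_eq_cinner cinner_zero_right)
    then have "(1 - t) * Re (qform x v) + t * Re (qform y v) = 0"
      by (simp add: z qform_add qform_scaleR complex_eq_iff)
    moreover have "0 \<le> (1 - t) * Re (qform x v)" "0 \<le> t * Re (qform y v)"
      using assms by (auto simp: density_def psd_def)
    ultimately have "(1 - t) * Re (qform x v) = 0" "t * Re (qform y v) = 0"
      by linarith+
    then have "Re (qform x v) = 0" "Re (qform y v) = 0"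
      using assms by auto
    then show ?thesis
      using assms psd_qform_0_imp_null by (auto simp: density_def)
  qed
  then show "qsupp_sub x z" "qsupp_sub y z" by (auto simp: qsupp_sub_def)
qed

lemma convex_on_rel_interiorI:
  fixes S :: "'v::euclidean_space set"
  assumes "convex S"
    and "\<And>x y z t. x \<in> S \<Longrightarrow> y \<in> S \<Longrightarrow> 0 < t \<Longrightarrow> t < 1 \<Longrightarrow> z = (1 - t) *\<^sub>R x + t *\<^sub>R y \<Longrightarrow> z \<in> S
      \<Longrightarrow> 0 \<le> (1 - t) * f x + t * f y - f z"
  shows "convex_on (rel_interior S) f"
proof (rule convex_on_subset)
  show "convex_on S f"
  proof (rule convex_onI)
    fix t :: real and x y :: 'v
    assume a: "t > 0" "t < 1" "x \<in> S" "y \<in> S"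
    then have "(1 - t) *\<^sub>R x + t *\<^sub>R y \<in> S"
      using assms(1) by (simp add: convex_alt)
    then show "f ((1 - t) *\<^sub>R x + t *\<^sub>R y) \<le> (1 - t) * f x + t * f y"
      using assms(2) [OF a(3,4,1,2) refl] by simp
  qed (rule assms(1))
qed (simp_all add: rel_interior_subset convex_rel_interior assms(1))

text \<open>Both gaps are the same weighted sums of relative entropies to the mixture, so the ratio
  bounds apply term by term. \<open>entropy_monotone\<close> does not include linearity, hence the
  separate hypothesis on \<open>M z\<close>.\<close>

lemma vN_gap_bounds:
  assumes M: "entropy_monotone M"
    and xy: "x \<in> density" "y \<in> density" and t: "0 < t" "t < 1"
    and z: "z = (1 - t) *\<^sub>R x + t *\<^sub>R y" and Mz: "M z = (1 - t) *\<^sub>R M x + t *\<^sub>R M y"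
  shows "etaQ M * (vN z - (1 - t) * vN x - t * vN y) \<le> vN (M z) - (1 - t) * vN (M x) - t * vN (M y)"
    and "vN (M z) - (1 - t) * vN (M x) - t * vN (M y) \<le> zetaQ M * (vN z - (1 - t) * vN x - t * vN y)"
proof -
  have zd: "z \<in> density"
    unfolding z using xy t convex_density by (intro convexD_alt) auto
  note supp = qsupp_sub_convex_comb [OF xy t z]
  have "(1 - t) * (etaQ M * qrel x z) + t * (etaQ M * qrel y z)
      \<le> (1 - t) * qrel (M x) (M z) + t * qrel (M y) (M z)"
    using t xy zd supp M by (intro add_mono mult_left_mono qratio_bounds) simp_all
  then show "etaQ M * (vN z - (1 - t) * vN x - t * vN y) \<le> vN (M z) - (1 - t) * vN (M x) - t * vN (M y)"
    unfolding vN_jensen_gap [OF z] vN_jensen_gap [OF Mz] by (simp add: algebra_simps)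
  have "(1 - t) * qrel (M x) (M z) + t * qrel (M y) (M z)
      \<le> (1 - t) * (zetaQ M * qrel x z) + t * (zetaQ M * qrel y z)"
    using t xy zd supp M by (intro add_mono mult_left_mono qratio_bounds) simp_all
  then show "vN (M z) - (1 - t) * vN (M x) - t * vN (M y) \<le> zetaQ M * (vN z - (1 - t) * vN x - t * vN y)"
    unfolding vN_jensen_gap [OF z] vN_jensen_gap [OF Mz] by (simp add: algebra_simps)
qed

section \<open>Classical channels\<close>

text \<open>Each term is bounded by \<open>ln x \<le> x - 1\<close> at
  \<open>x = (b j * A) / (a j * B)\<close>, and the resulting lower bounds sum to zero. It yields
  both nonnegativity of \<open>kl_div\<close> and classical data processing.\<close>

lemma log_sum_inequality:
  fixes a b :: "'i \<Rightarrow> real"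
  assumes "finite S" "\<And>j. j \<in> S \<Longrightarrow> 0 \<le> a j" "\<And>j. j \<in> S \<Longrightarrow> 0 \<le> b j"
    and ab: "\<And>j. j \<in> S \<Longrightarrow> b j = 0 \<Longrightarrow> a j = 0"
  shows "(\<Sum>j\<in>S. a j) * ln ((\<Sum>j\<in>S. a j) / (\<Sum>j\<in>S. b j)) \<le> (\<Sum>j\<in>S. a j * ln (a j / b j))"
proof (cases "(\<Sum>j\<in>S. a j) = 0")
  case True
  then have "\<forall>j\<in>S. a j = 0" using assms by (subst (asm) sum_nonneg_eq_0_iff) auto
  then show ?thesis by simp
next
  case False
  define A B where "A = (\<Sum>j\<in>S. a j)" and "B = (\<Sum>j\<in>S. b j)"
  have "0 \<le> A" "0 \<le> B" unfolding A_def B_def using assms by (auto intro: sum_nonneg)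
  have "B \<noteq> 0"
  proof
    assume "B = 0"
    then have "\<forall>j\<in>S. b j = 0" unfolding B_def using assms by (subst (asm) sum_nonneg_eq_0_iff) auto
    then show False using False ab by simp
  qed
  then have pos: "0 < A" "0 < B" using False \<open>0 \<le> A\<close> \<open>0 \<le> B\<close> by (auto simp: A_def)
  have "a j - b j * (A / B) \<le> a j * ln (a j / b j) - a j * ln (A / B)" if j: "j \<in> S" for j
  proof (cases "a j = 0")
    case True
    then show ?thesis using pos assms(3) [OF j] by simp
  next
    case False
    then have p: "0 < a j" "0 < b j" using assms(2,3) [OF j] ab [OF j] by (auto simp: less_le)
    have "ln ((b j * A) / (a j * B)) \<le> (b j * A) / (a j * B) - 1"
      using p pos by (intro ln_le_minus_one) simp
    then have "1 - (b j * A) / (a j * B) \<le> ln (a j / b j) - ln (A / B)"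
      using p pos by (simp add: ln_div ln_mult)
    then have "a j * (1 - (b j * A) / (a j * B)) \<le> a j * (ln (a j / b j) - ln (A / B))"
      using p by (intro mult_left_mono) simp_all
    then show ?thesis using p by (simp add: right_diff_distrib)
  qed
  then have "(\<Sum>j\<in>S. a j - b j * (A / B)) \<le> (\<Sum>j\<in>S. a j * ln (a j / b j) - a j * ln (A / B))"
    by (rule sum_mono)
  also have "\<dots> = (\<Sum>j\<in>S. a j * ln (a j / b j)) - A * ln (A / B)"
    by (simp only: sum_subtractf sum_distrib_right [symmetric] A_def)
  finally have "A - B * (A / B) \<le> (\<Sum>j\<in>S. a j * ln (a j / b j)) - A * ln (A / B)"
    by (simp only: sum_subtractf sum_distrib_right [symmetric] A_def [symmetric] B_def [symmetric])
  then show ?thesis using pos by (simp add: A_def B_def)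
qed

lemma prob_simplex_nonneg: "p \<in> prob_simplex \<Longrightarrow> 0 \<le> p $ i"
  by (simp add: prob_simplex_def)

lemma kl_div_nonneg:
  assumes "p \<in> prob_simplex" "q \<in> prob_simplex" "supp_sub p q"
  shows "0 \<le> kl_div p q"
  using log_sum_inequality [of UNIV "\<lambda>i. p $ i" "\<lambda>i. q $ i"] assms
  by (simp add: kl_div_def prob_simplex_def supp_sub_def)

lemma column_stochastic_nonneg: "column_stochastic Q \<Longrightarrow> 0 \<le> Q $ i $ j"
  by (simp add: column_stochastic_def)

lemma prob_simplex_stochastic:
  assumes Q: "column_stochastic Q" and p: "p \<in> prob_simplex"
  shows "Q *v p \<in> prob_simplex"
proof -
  have "(\<Sum>i\<in>UNIV. \<Sum>j\<in>UNIV. Q $ i $ j * p $ j) = (\<Sum>j\<in>UNIV. \<Sum>i\<in>UNIV. Q $ i $ j * p $ j)"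
    by (rule sum.swap)
  also have "\<dots> = 1"
    using Q p by (simp add: column_stochastic_def prob_simplex_def flip: sum_distrib_right)
  finally show ?thesis
    using Q p by (auto simp: prob_simplex_def matrix_vector_mult_def column_stochastic_def intro!: sum_nonneg)
qed

lemma supp_sub_stochastic:
  assumes Q: "column_stochastic Q" and pq: "p \<in> prob_simplex" "q \<in> prob_simplex" "supp_sub p q"
  shows "supp_sub (Q *v p) (Q *v q)"
  unfolding supp_sub_def
proof (intro allI impI)
  fix i assume "(Q *v q) $ i = 0"
  then have "\<forall>j\<in>UNIV. Q $ i $ j * q $ j = 0"
    unfolding matrix_vector_mult_def using Q pq
    by (simp add: sum_nonneg_eq_0_iff column_stochastic_nonneg prob_simplex_nonneg)
  then have "\<forall>j. Q $ i $ j * p $ j = 0" using pq by (auto simp: supp_sub_def)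
  then show "(Q *v p) $ i = 0" by (simp only: matrix_vector_mult_def vec_lambda_beta sum.neutral_const)
qed

text \<open>The log-sum inequality for each output \<open>i\<close>, where the factor
  \<open>Q $ i $ j\<close> cancels inside the logarithm; the unit column sums then remove
  \<open>Q\<close>.\<close>

lemma kl_div_stochastic_le:
  assumes Q: "column_stochastic Q" and pq: "p \<in> prob_simplex" "q \<in> prob_simplex" "supp_sub p q"
  shows "kl_div (Q *v p) (Q *v q) \<le> kl_div p q"
proof -
  have "(Q *v p) $ i * ln ((Q *v p) $ i / (Q *v q) $ i) \<le> (\<Sum>j\<in>UNIV. Q $ i $ j * (p $ j * ln (p $ j / q $ j)))" for i
  proof -
    have "(\<Sum>j\<in>UNIV. Q $ i $ j * p $ j) * ln ((\<Sum>j\<in>UNIV. Q $ i $ j * p $ j) / (\<Sum>j\<in>UNIV. Q $ i $ j * q $ j))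
        \<le> (\<Sum>j\<in>UNIV. Q $ i $ j * p $ j * ln (Q $ i $ j * p $ j / (Q $ i $ j * q $ j)))"
      using Q pq by (intro log_sum_inequality)
        (auto simp: column_stochastic_nonneg prob_simplex_nonneg supp_sub_def)
    also have "\<dots> = (\<Sum>j\<in>UNIV. Q $ i $ j * (p $ j * ln (p $ j / q $ j)))"
      by (intro sum.cong refl) auto
    finally show ?thesis by (simp add: matrix_vector_mult_def)
  qed
  then have "kl_div (Q *v p) (Q *v q) \<le> (\<Sum>i\<in>UNIV. \<Sum>j\<in>UNIV. Q $ i $ j * (p $ j * ln (p $ j / q $ j)))"
    unfolding kl_div_def by (intro sum_mono)
  also have "\<dots> = (\<Sum>j\<in>UNIV. \<Sum>i\<in>UNIV. Q $ i $ j * (p $ j * ln (p $ j / q $ j)))"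
    by (rule sum.swap)
  also have "\<dots> = kl_div p q"
    using Q by (simp add: kl_div_def column_stochastic_def flip: sum_distrib_right)
  finally show ?thesis .
qed

lemma cratio_bounds:
  assumes Q: "column_stochastic Q" and a: "p \<in> prob_simplex" "q \<in> prob_simplex" "supp_sub p q"
  shows "etaC Q * kl_div p q \<le> kl_div (Q *v p) (Q *v q)" "kl_div (Q *v p) (Q *v q) \<le> zetaC Q * kl_div p q"
proof -
  have nn: "0 \<le> kl_div p q" "0 \<le> kl_div (Q *v p) (Q *v q)" "kl_div (Q *v p) (Q *v q) \<le> kl_div p q"
    if "p \<in> prob_simplex" "q \<in> prob_simplex" "supp_sub p q" for p q
    using that Q kl_div_nonneg prob_simplex_stochastic supp_sub_stochastic kl_div_stochastic_le by blast+
  have bounds: "0 \<le> x \<and> x \<le> 1" if x: "x \<in> cratios Q" for x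
  proof -
    obtain p q where "x = kl_div (Q *v p) (Q *v q) / kl_div p q"
      "p \<in> prob_simplex" "q \<in> prob_simplex" "supp_sub p q"
      using x unfolding cratios_def by blast
    then show ?thesis using nn [of p q] by (auto simp: divide_le_eq_1)
  qed
  then have bdd: "bdd_above (cratios Q)" "bdd_below (cratios Q)"
    unfolding bdd_above_def bdd_below_def by blast+
  have "etaC Q * kl_div p q \<le> kl_div (Q *v p) (Q *v q) \<and> kl_div (Q *v p) (Q *v q) \<le> zetaC Q * kl_div p q"
  proof (cases "kl_div p q = 0")
    case True
    then show ?thesis using nn [OF a] by simp
  next
    case False
    then have pos: "0 < kl_div p q" using nn(1) [OF a] by simp
    have "p \<noteq> q"
    proof
      assume "p = q"
      moreover have "x * ln (x / x) = 0" for x :: real by (cases "x = 0") auto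
      ultimately have "kl_div p q = 0" by (simp only: kl_div_def sum.neutral_const)
      with False show False by simp
    qed
    then have "kl_div (Q *v p) (Q *v q) / kl_div p q \<in> cratios Q"
      using a unfolding cratios_def by blast
    then have "etaC Q \<le> kl_div (Q *v p) (Q *v q) / kl_div p q" "kl_div (Q *v p) (Q *v q) / kl_div p q \<le> zetaC Q"
      unfolding etaC_def zetaC_def using bdd by (auto intro: cInf_lower cSup_upper)
    then show ?thesis using pos by (simp add: le_divide_eq divide_le_eq)
  qed
  then show "etaC Q * kl_div p q \<le> kl_div (Q *v p) (Q *v q)" "kl_div (Q *v p) (Q *v q) \<le> zetaC Q * kl_div p q"
    by auto
qed

lemma convex_prob_simplex: "convex prob_simplex"
  unfolding convex_def prob_simplex_def
  by (auto simp: sum.distrib simp flip: sum_distrib_left)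

lemma supp_sub_convex_comb:
  assumes "x \<in> prob_simplex" "y \<in> prob_simplex" "0 < t" "t < 1" and z: "z = (1 - t) *\<^sub>R x + t *\<^sub>R y"
  shows "supp_sub x z" "supp_sub y z"
proof -
  have "x $ i = 0 \<and> y $ i = 0" if "z $ i = 0" for i
  proof -
    have "0 \<le> (1 - t) * x $ i" "0 \<le> t * y $ i"
      using assms by (simp_all add: prob_simplex_nonneg)
    moreover have "(1 - t) * x $ i + t * y $ i = 0"
      using that by (simp add: z)
    ultimately have "(1 - t) * x $ i = 0" "t * y $ i = 0" by linarith+
    then show ?thesis using assms by simp
  qed
  then show "supp_sub x z" "supp_sub y z" by (auto simp: supp_sub_def)
qed

lemma kl_div_eq:
  assumes "p \<in> prob_simplex" "q \<in> prob_simplex" "supp_sub p q"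
  shows "kl_div p q = - shannon p - (\<Sum>i\<in>UNIV. p $ i * ln (q $ i))"
proof -
  have "p $ i * ln (p $ i / q $ i) = p $ i * ln (p $ i) - p $ i * ln (q $ i)" for i
  proof (cases "p $ i = 0")
    case False
    then have "0 < p $ i" "0 < q $ i"
      using assms prob_simplex_nonneg [of p i] prob_simplex_nonneg [of q i] by (auto simp: supp_sub_def less_le)
    then show ?thesis by (simp add: ln_div right_diff_distrib)
  qed simp
  then show ?thesis by (simp add: kl_div_def shannon_def sum_subtractf)
qed

text \<open>Here the relative entropy contains the logarithm of a quotient, so nested supports are
  used to split it before the cross terms are matched.\<close>

lemma shannon_jensen_gap:
  assumes xy: "x \<in> prob_simplex" "y \<in> prob_simplex" and t: "0 < t" "t < 1"
    and z: "z = (1 - t) *\<^sub>R x + t *\<^sub>R y"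
  shows "shannon z - (1 - t) * shannon x - t * shannon y = (1 - t) * kl_div x z + t * kl_div y z"
proof -
  have zp: "z \<in> prob_simplex"
    unfolding z using xy t convex_prob_simplex by (intro convexD_alt) auto
  have "(\<Sum>i\<in>UNIV. z $ i * ln (z $ i)) = (\<Sum>i\<in>UNIV. ((1 - t) * x $ i + t * y $ i) * ln (z $ i))"
    by (simp add: z)
  also have "\<dots> = (1 - t) * (\<Sum>i\<in>UNIV. x $ i * ln (z $ i)) + t * (\<Sum>i\<in>UNIV. y $ i * ln (z $ i))"
    by (simp only: distrib_right sum.distrib sum_distrib_left mult.assoc)
  finally show ?thesis
    unfolding kl_div_eq [OF xy(1) zp supp_sub_convex_comb(1) [OF xy t z]]
      kl_div_eq [OF xy(2) zp supp_sub_convex_comb(2) [OF xy t z]]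
    by (simp add: shannon_def [of z] algebra_simps)
qed

lemma shannon_gap_bounds:
  assumes Q: "column_stochastic Q"
    and xy: "x \<in> prob_simplex" "y \<in> prob_simplex" and t: "0 < t" "t < 1"
    and z: "z = (1 - t) *\<^sub>R x + t *\<^sub>R y"
  shows "etaC Q * (shannon z - (1 - t) * shannon x - t * shannon y)
      \<le> shannon (Q *v z) - (1 - t) * shannon (Q *v x) - t * shannon (Q *v y)"
    and "shannon (Q *v z) - (1 - t) * shannon (Q *v x) - t * shannon (Q *v y)
      \<le> zetaC Q * (shannon z - (1 - t) * shannon x - t * shannon y)"
proof -
  have zp: "z \<in> prob_simplex"
    unfolding z using xy t convex_prob_simplex by (intro convexD_alt) auto
  have Qz: "Q *v z = (1 - t) *\<^sub>R (Q *v x) + t *\<^sub>R (Q *v y)"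
    by (simp add: z matrix_vector_right_distrib matrix_vector_mult_scaleR)
  note supp = supp_sub_convex_comb [OF xy t z]
  note gap = shannon_jensen_gap [OF xy t z]
    shannon_jensen_gap [OF prob_simplex_stochastic [OF Q xy(1)] prob_simplex_stochastic [OF Q xy(2)] t Qz]
  have "(1 - t) * (etaC Q * kl_div x z) + t * (etaC Q * kl_div y z)
      \<le> (1 - t) * kl_div (Q *v x) (Q *v z) + t * kl_div (Q *v y) (Q *v z)"
    using t xy zp supp Q by (intro add_mono mult_left_mono cratio_bounds) simp_all
  then show "etaC Q * (shannon z - (1 - t) * shannon x - t * shannon y)
      \<le> shannon (Q *v z) - (1 - t) * shannon (Q *v x) - t * shannon (Q *v y)"
    unfolding gap by (simp add: algebra_simps)
  have "(1 - t) * kl_div (Q *v x) (Q *v z) + t * kl_div (Q *v y) (Q *v z)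
      \<le> (1 - t) * (zetaC Q * kl_div x z) + t * (zetaC Q * kl_div y z)"
    using t xy zp supp Q by (intro add_mono mult_left_mono cratio_bounds) simp_all
  then show "shannon (Q *v z) - (1 - t) * shannon (Q *v x) - t * shannon (Q *v y)
      \<le> zetaC Q * (shannon z - (1 - t) * shannon x - t * shannon y)"
    unfolding gap by (simp add: algebra_simps)
qed

text \<open>Exhibits the mutual information as a linear function of \<open>p\<close> plus the output
  entropy, so that its Jensen gap is that of the output entropy.\<close>

lemma Ic_eq:
  assumes Q: "column_stochastic Q" and p: "p \<in> prob_simplex"
  shows "Ic Q p = (\<Sum>j\<in>UNIV. p $ j * (\<Sum>i\<in>UNIV. Q $ i $ j * ln (Q $ i $ j))) + shannon (Q *v p)"
proof -
  have Qp: "(\<Sum>k\<in>UNIV. p $ k * Q $ i $ k) = (Q *v p) $ i" for i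
    by (simp add: matrix_vector_mult_def mult.commute)
  have "p $ j * Q $ i $ j * ln (Q $ i $ j / (Q *v p) $ i)
      = p $ j * (Q $ i $ j * ln (Q $ i $ j)) - Q $ i $ j * p $ j * ln ((Q *v p) $ i)" for i j
  proof (cases "p $ j * Q $ i $ j = 0")
    case False
    then have pos: "0 < Q $ i $ j" "0 < p $ j"
      using column_stochastic_nonneg [OF Q, of i j] prob_simplex_nonneg [OF p, of j] by (auto simp: less_le)
    \<comment> \<open>A nonzero weight forces a positive output probability, so the logarithm of the
      quotient splits.\<close>
    have "0 < Q $ i $ j * p $ j" using pos by simp
    also have "\<dots> \<le> (\<Sum>k\<in>UNIV. Q $ i $ k * p $ k)"
      using Q p by (intro member_le_sum) (simp_all add: column_stochastic_nonneg prob_simplex_nonneg)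
    finally have "0 < (Q *v p) $ i" by (simp add: matrix_vector_mult_def)
    then show ?thesis using pos by (simp add: ln_div algebra_simps)
  qed auto
  then have "Ic Q p = (\<Sum>j\<in>UNIV. \<Sum>i\<in>UNIV. p $ j * (Q $ i $ j * ln (Q $ i $ j)))
      - (\<Sum>j\<in>UNIV. \<Sum>i\<in>UNIV. Q $ i $ j * p $ j * ln ((Q *v p) $ i))"
    by (simp add: Ic_def Qp sum_subtractf)
  also have "(\<Sum>j\<in>UNIV. \<Sum>i\<in>UNIV. Q $ i $ j * p $ j * ln ((Q *v p) $ i))
      = (\<Sum>i\<in>UNIV. \<Sum>j\<in>UNIV. Q $ i $ j * p $ j * ln ((Q *v p) $ i))"
    by (rule sum.swap)
  also have "\<dots> = - shannon (Q *v p)"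
    by (simp add: shannon_def matrix_vector_mult_def sum_distrib_right)
  finally show ?thesis by (simp add: sum_distrib_left)
qed

section \<open>Probability vectors as diagonal density matrices\<close>

lemma vN_diagm: "vN (diagm (\<lambda>i. p $ i)) = shannon p"
proof -
  have ct: "ctrans (mat 1) = (mat 1 :: complex^'a^'a)"
    by (simp add: vec_eq_iff mat_def)
  have "unitary_mat (mat 1 :: complex^'a^'a)"
    by (simp add: unitary_mat_def ct)
  moreover have "diagm d = mat 1 ** diagm d ** ctrans (mat 1)" for d :: "'a \<Rightarrow> real"
    by (simp add: ct)
  ultimately have "mfun ln (diagm (\<lambda>i. p $ i)) = diagm (ln \<circ> (\<lambda>i. p $ i))"
    by (metis mfun_eq)
  then show ?thesis
    by (simp add: vN_def shannon_def trace_def diagm_mult_nth diagm_nth)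
qed

lemma diagm_density: "p \<in> prob_simplex \<Longrightarrow> diagm (\<lambda>i. p $ i) \<in> density"
  unfolding density_def prob_simplex_def
  by (simp add: psd_diagm trace_def diagm_nth flip: of_real_sum)

lemma diagm_convex_comb:
  "diagm (\<lambda>i. ((1 - t) *\<^sub>R x + t *\<^sub>R y) $ i) = (1 - t) *\<^sub>R diagm (\<lambda>i. x $ i) + t *\<^sub>R diagm (\<lambda>i. y $ i)"
  by (simp add: vec_eq_iff diagm_nth) (simp add: scaleR_conv_of_real)

text \<open>Identifies the ensemble average with the encoded diagonal state, so the Holevo quantity
  becomes an output entropy of \<open>N \<circ> E\<close> minus a linear term.\<close>

lemma qchannel_diagm:
  assumes "qchannel E"
  shows "(\<Sum>j\<in>UNIV. p $ j *\<^sub>R E (ketbra j j)) = E (diagm (\<lambda>j. p $ j))"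
proof -
  have "diagm (\<lambda>j. p $ j) $ k $ l = (\<Sum>j\<in>UNIV. p $ j *\<^sub>R ketbra j j) $ k $ l" for k l
  proof -
    have "(\<Sum>j\<in>UNIV. p $ j *\<^sub>R ketbra j j) $ k $ l
        = (\<Sum>j\<in>UNIV. if j = k then (if k = l then complex_of_real (p $ k) else 0) else 0)"
      unfolding sum_component vector_scaleR_component ketbra_nth
      by (intro sum.cong refl) (auto simp: scaleR_conv_of_real)
    then show ?thesis by (simp add: diagm_nth)
  qed
  then have "diagm (\<lambda>j. p $ j) = (\<Sum>j\<in>UNIV. p $ j *\<^sub>R ketbra j j)"
    by (simp add: vec_eq_iff)
  then show ?thesis using assms by (simp add: qchannel_sum qchannel_scaleR)
qed

lemma qchannel_convex_comb:
  "qchannel M \<Longrightarrow> M ((1 - t) *\<^sub>R x + t *\<^sub>R y) = (1 - t) *\<^sub>R M x + t *\<^sub>R M y"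
  using qchannel_scaleR [of M] by (simp add: qchannel_def)

section \<open>Smoothness and strong convexity of the three information quantities\<close>

theorem mainTheorem7:
  fixes Q :: "real^'m::finite^'n::finite"
    and N :: "complex^'a::finite^'a \<Rightarrow> complex^'b::finite^'b"
    and E :: "complex^'m^'m \<Rightarrow> complex^'a^'a"
    and U :: "complex^'a^('b \<times> 'e::finite)"
  assumes Q: "column_stochastic Q"
    and N: "qchannel N"
    and E: "qchannel E"
    and U: "isometry U"
    and stine: "\<forall>\<rho>. N \<rho> = ptrace_E (U ** \<rho> ** ctrans U)"
  shows
   "rel_smooth (zetaC Q) (\<lambda>p. - Ic Q p) (\<lambda>p. - shannon p) (rel_interior prob_simplex)
    \<and> rel_strongly_convex (etaC Q) (\<lambda>p. - Ic Q p) (\<lambda>p. - shannon p) (rel_interior prob_simplex)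
    \<and> rel_smooth (zetaQ (N \<circ> E)) (\<lambda>p. - holevo N E p) (\<lambda>p. - shannon p) (rel_interior prob_simplex)
    \<and> rel_strongly_convex (etaQ (N \<circ> E)) (\<lambda>p. - holevo N E p) (\<lambda>p. - shannon p) (rel_interior prob_simplex)
    \<and> rel_smooth (1 + zetaQ N - etaQ (\<lambda>\<rho>. ptrace_B (U ** \<rho> ** ctrans U)))
        (\<lambda>\<rho>. - Iq U \<rho>) (\<lambda>\<rho>. - vN \<rho>) (rel_interior density)
    \<and> rel_strongly_convex (1 + etaQ N - zetaQ (\<lambda>\<rho>. ptrace_B (U ** \<rho> ** ctrans U)))
        (\<lambda>\<rho>. - Iq U \<rho>) (\<lambda>\<rho>. - vN \<rho>) (rel_interior density)"
proof -
  define Nc where "Nc = (\<lambda>\<rho>. ptrace_B (U ** \<rho> ** ctrans U))"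
  have monN: "entropy_monotone N" using N by (rule entropy_monotone_qchannel)
  have monNE: "entropy_monotone (N \<circ> E)"
    using monN entropy_monotone_qchannel [OF E] by (rule entropy_monotone_comp)
  have monNc: "entropy_monotone Nc"
    using complementary_kraus [OF U] entropy_monotone_kraus unfolding Nc_def by metis
  have Nc_comb: "Nc ((1 - t) *\<^sub>R x + t *\<^sub>R y) = (1 - t) *\<^sub>R Nc x + t *\<^sub>R Nc y" for t x y
    by (simp add: Nc_def matrix_add_ldistrib matrix_add_rdistrib matrix_mult_scaleR_left matrix_mult_scaleR_right)
      (simp add: vec_eq_iff ptrace_B_def sum.distrib scaleR_sum_right)
  have Iq_eq: "Iq U \<rho> = vN \<rho> + vN (N \<rho>) - vN (Nc \<rho>)" for \<rho>
    using stine by (simp add: Iq_def Nc_def)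
  \<comment> \<open>\<open>c\<close> and \<open>h\<close> are the linear parts of \<open>Ic\<close>
    and \<open>holevo\<close>; they drop out of the Jensen gaps.\<close>
  define c where "c p = (\<Sum>j\<in>UNIV. p $ j * (\<Sum>i\<in>UNIV. Q $ i $ j * ln (Q $ i $ j)))" for p :: "real^'m"
  define h where "h p = (\<Sum>j\<in>UNIV. p $ j * vN (N (E (ketbra j j))))" for p :: "real^'m"
  have c_comb: "c ((1 - t) *\<^sub>R x + t *\<^sub>R y) = (1 - t) * c x + t * c y" for t x y
    by (simp add: c_def distrib_right sum.distrib sum_distrib_left mult.assoc)
  have h_comb: "h ((1 - t) *\<^sub>R x + t *\<^sub>R y) = (1 - t) * h x + t * h y" for t x y
    by (simp add: h_def distrib_right sum.distrib sum_distrib_left mult.assoc)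
  have Ic_c: "Ic Q p = c p + shannon (Q *v p)" if "p \<in> prob_simplex" for p
    using Ic_eq [OF Q that] by (simp add: c_def)
  have holevo_h: "holevo N E p = vN ((N \<circ> E) (diagm (\<lambda>j. p $ j))) - h p" for p
    by (simp add: holevo_def h_def qchannel_diagm [OF E])
  have Ic_gap: "etaC Q * (shannon z - (1 - t) * shannon x - t * shannon y)
        \<le> Ic Q z - (1 - t) * Ic Q x - t * Ic Q y"
      "Ic Q z - (1 - t) * Ic Q x - t * Ic Q y
        \<le> zetaC Q * (shannon z - (1 - t) * shannon x - t * shannon y)"
    if "x \<in> prob_simplex" "y \<in> prob_simplex" "0 < t" "t < 1" "z = (1 - t) *\<^sub>R x + t *\<^sub>R y"
      "z \<in> prob_simplex" for x y z t
    using shannon_gap_bounds [OF Q that(1-5)] c_comb [of t x y]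
    unfolding Ic_c [OF that(1)] Ic_c [OF that(2)] Ic_c [OF that(6)] that(5) [symmetric]
    by (simp_all add: algebra_simps)
  have holevo_gap: "etaQ (N \<circ> E) * (shannon z - (1 - t) * shannon x - t * shannon y)
        \<le> holevo N E z - (1 - t) * holevo N E x - t * holevo N E y"
      "holevo N E z - (1 - t) * holevo N E x - t * holevo N E y
        \<le> zetaQ (N \<circ> E) * (shannon z - (1 - t) * shannon x - t * shannon y)"
    if "x \<in> prob_simplex" "y \<in> prob_simplex" "0 < t" "t < 1" and z: "z = (1 - t) *\<^sub>R x + t *\<^sub>R y"
    for x y z t
  proof -
    \<comment> \<open>The coefficients of \<open>N \<circ> E\<close> range over all density
      matrices, in particular diagonal ones, where the reference entropy reduces to
      \<open>shannon\<close>.\<close>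
    let ?D = "\<lambda>p :: real^'m. diagm (\<lambda>j. p $ j)"
    have Dz: "?D z = (1 - t) *\<^sub>R ?D x + t *\<^sub>R ?D y"
      unfolding z by (rule diagm_convex_comb)
    have "(N \<circ> E) (?D z) = (1 - t) *\<^sub>R (N \<circ> E) (?D x) + t *\<^sub>R (N \<circ> E) (?D y)"
      by (simp add: Dz qchannel_convex_comb N E)
    note gap = vN_gap_bounds [OF monNE diagm_density [OF that(1)] diagm_density [OF that(2)] that(3,4) Dz this]
    show "etaQ (N \<circ> E) * (shannon z - (1 - t) * shannon x - t * shannon y)
        \<le> holevo N E z - (1 - t) * holevo N E x - t * holevo N E y"
      "holevo N E z - (1 - t) * holevo N E x - t * holevo N E y
        \<le> zetaQ (N \<circ> E) * (shannon z - (1 - t) * shannon x - t * shannon y)"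
      using gap h_comb [of t x y]
      unfolding holevo_h vN_diagm z [symmetric] by (simp_all add: algebra_simps comp_def)
  qed
  have N_gap: "etaQ N * (vN z - (1 - t) * vN x - t * vN y) \<le> vN (N z) - (1 - t) * vN (N x) - t * vN (N y)"
      "vN (N z) - (1 - t) * vN (N x) - t * vN (N y) \<le> zetaQ N * (vN z - (1 - t) * vN x - t * vN y)"
    and Nc_gap: "etaQ Nc * (vN z - (1 - t) * vN x - t * vN y) \<le> vN (Nc z) - (1 - t) * vN (Nc x) - t * vN (Nc y)"
      "vN (Nc z) - (1 - t) * vN (Nc x) - t * vN (Nc y) \<le> zetaQ Nc * (vN z - (1 - t) * vN x - t * vN y)"
    if "x \<in> density" "y \<in> density" "0 < t" "t < 1" and z: "z = (1 - t) *\<^sub>R x + t *\<^sub>R y" for x y z t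
    using vN_gap_bounds [OF monN that] vN_gap_bounds [OF monNc that]
    by (simp_all add: z qchannel_convex_comb [OF N] Nc_comb)
  show ?thesis
    unfolding rel_smooth_def rel_strongly_convex_def Nc_def [symmetric] Iq_eq
  proof (intro conjI)
    show "convex_on (rel_interior prob_simplex) (\<lambda>p. zetaC Q * - shannon p - - Ic Q p)"
      using Ic_gap(2) by (intro convex_on_rel_interiorI convex_prob_simplex) (simp add: algebra_simps)
    show "convex_on (rel_interior prob_simplex) (\<lambda>p. - Ic Q p - etaC Q * - shannon p)"
      using Ic_gap(1) by (intro convex_on_rel_interiorI convex_prob_simplex) (simp add: algebra_simps)
    show "convex_on (rel_interior prob_simplex) (\<lambda>p. zetaQ (N \<circ> E) * - shannon p - - holevo N E p)"
      using holevo_gap(2) by (intro convex_on_rel_interiorI convex_prob_simplex) (simp add: algebra_simps)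
    show "convex_on (rel_interior prob_simplex) (\<lambda>p. - holevo N E p - etaQ (N \<circ> E) * - shannon p)"
      using holevo_gap(1) by (intro convex_on_rel_interiorI convex_prob_simplex) (simp add: algebra_simps)
    \<comment> \<open>The term \<open>vN\<close> contributes exactly one reference gap and
      \<open>N\<close> at most \<open>zetaQ N\<close> of them. \<open>Nc\<close> enters with a minus
      sign, so its lower coefficient \<open>etaQ Nc\<close> bounds the total from above; the roles
      are exchanged for strong convexity.\<close>
    show "convex_on (rel_interior density)
        (\<lambda>\<rho>. (1 + zetaQ N - etaQ Nc) * - vN \<rho> - - (vN \<rho> + vN (N \<rho>) - vN (Nc \<rho>)))"
    proof (intro convex_on_rel_interiorI convex_density)
      fix x y z :: "complex^'a^'a" and t :: real
      assume a: "x \<in> density" "y \<in> density" "0 < t" "t < 1" "z = (1 - t) *\<^sub>R x + t *\<^sub>R y"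
      show "0 \<le> (1 - t) * ((1 + zetaQ N - etaQ Nc) * - vN x - - (vN x + vN (N x) - vN (Nc x)))
          + t * ((1 + zetaQ N - etaQ Nc) * - vN y - - (vN y + vN (N y) - vN (Nc y)))
          - ((1 + zetaQ N - etaQ Nc) * - vN z - - (vN z + vN (N z) - vN (Nc z)))"
        using N_gap(2) [OF a] Nc_gap(1) [OF a] by (simp add: algebra_simps)
    qed
    show "convex_on (rel_interior density)
        (\<lambda>\<rho>. - (vN \<rho> + vN (N \<rho>) - vN (Nc \<rho>)) - (1 + etaQ N - zetaQ Nc) * - vN \<rho>)"
    proof (intro convex_on_rel_interiorI convex_density)
      fix x y z :: "complex^'a^'a" and t :: real
      assume a: "x \<in> density" "y \<in> density" "0 < t" "t < 1" "z = (1 - t) *\<^sub>R x + t *\<^sub>R y"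
      show "0 \<le> (1 - t) * (- (vN x + vN (N x) - vN (Nc x)) - (1 + etaQ N - zetaQ Nc) * - vN x)
          + t * (- (vN y + vN (N y) - vN (Nc y)) - (1 + etaQ N - zetaQ Nc) * - vN y)
          - (- (vN z + vN (N z) - vN (Nc z)) - (1 + etaQ N - zetaQ Nc) * - vN z)"
        using N_gap(1) [OF a] Nc_gap(2) [OF a] by (simp add: algebra_simps)
    qed
  qed
qed

end
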